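(* Let $T$ be a visceral complete theory which has definable finite choice and has no space-filling functions, and let $\mathfrak M=(M,\dots)$ be an $\omega$-saturated model of $T$ with a fixed visceral definable uniform structure $\mathcal B$ (topology on $M$ and product topology on $M^n$ as induced by $\mathcal B$). If $X\subseteq M^m$ and $Y\subseteq M^n$ are definable and there is a definable bijection $f:X\to Y$, then $\dim(X)=\dim(Y)$.
   Context: "Definable" means definable with parameters. A base for a uniform structure on $M$ is a nonempty family $\mathcal{B}$ of subsets of $M\times M$ such that: for $D_1,D_2\in\mathcal B$ some $E\in\mathcal B$ satisfies $E\subseteq D_1\cap D_2$; every $D\in\mathcal B$ contains the diagonal; for $D\in\mathcal B$ some $E\in\mathcal B$ satisfies $E\subseteq D^{-1}=\{(y,x):(x,y)\in D\}$; for $D\in\mathcal B$ some $E\in\mathcal B$ satisfies $E\circ E\subseteq D$, where $E\circ E=\{(x,y):\exists z\,[(x,z),(z,y)\in E]\}$. A definable uniform structure is such a base of the form $\{\varphi(M^2;\bar b):\mathfrak M\models\psi(\bar b)\}$ for formulas $\varphi,\psi$, with symmetric members. Balls $D[x]=\{y:(x,y)\in D\}$ ($D\in\mathcal B$) form a base of the uniform topology. $\mathcal B$ is visceral if (1) for every $D\in\mathcal B$, $x\in M$ there is $E\in\mathcal B$ with $E[x]\subsetneq D[x]$, and (2) every infinite definable subset of $M$ has nonempty interior. $T$ is visceral if some $\omega$-saturated model admits a visceral definable uniform structure. $T$ has definable finite choice if for every $\omega$-saturated model and every definable $f:X\to M^n$, $X\subseteq M^m$, with all fibers $f^{-1}(y)$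 ($y\in f[X]$) finite, there is a definable $\sigma:f[X]\to X$ with $f(\sigma(y))=y$. A coordinate projection $M^n\to M^k$ is $(x_1,\dots,x_n)\mapsto (x_{i_1},\dots,x_{i_k})$ with $i_1<\dots<i_k$, $M^0$ being a point. For $X\subseteq M^n$, $\dim(X)$ is the largest $k\le n$ such that $\pi[X]$ has nonempty interior for some coordinate projection $\pi:M^n\to M^k$. A space-filling function is a surjective function $f:X\to Y$ with $X\subseteq M^m$, $Y\subseteq M^n$, $m<n$ and $Y$ having nonempty interior; $T$ has no space-filling functions if no model of $T$ (with the topology given by the same formulas defining $\mathcal B$) has a definable space-filling function. *)

theory Defs
  imports "HOL-Analysis.Analysis"
begin

section \<open>First-order logic\<close>

record ('f, 'r) language =
  fun_syms :: "'f set"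
  rel_syms :: "'r set"
  fun_arity :: "'f \<Rightarrow> nat"
  rel_arity :: "'r \<Rightarrow> nat"

datatype 'f fo_term = Var nat | Fun 'f "'f fo_term list"

datatype ('f, 'r) formula =
    Eq "'f fo_term" "'f fo_term"
  | Rel 'r "'f fo_term list"
  | Neg "('f, 'r) formula"
  | Conj "('f, 'r) formula" "('f, 'r) formula"
  | Ex nat "('f, 'r) formula"

fun is_term :: "('f, 'r) language \<Rightarrow> 'f fo_term \<Rightarrow> bool" where
  "is_term L (Var i) \<longleftrightarrow> True"
| "is_term L (Fun g ts) \<longleftrightarrow>
     g \<in> fun_syms L \<and> length ts = fun_arity L g \<and> (\<forall>t\<in>set ts. is_term L t)"

fun is_formula :: "('f, 'r) language \<Rightarrow> ('f, 'r) formula \<Rightarrow> bool" where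
  "is_formula L (Eq s t) \<longleftrightarrow> is_term L s \<and> is_term L t"
| "is_formula L (Rel r ts) \<longleftrightarrow>
     r \<in> rel_syms L \<and> length ts = rel_arity L r \<and> (\<forall>t\<in>set ts. is_term L t)"
| "is_formula L (Neg \<phi>) \<longleftrightarrow> is_formula L \<phi>"
| "is_formula L (Conj \<phi> \<psi>) \<longleftrightarrow> is_formula L \<phi> \<and> is_formula L \<psi>"
| "is_formula L (Ex i \<phi>) \<longleftrightarrow> is_formula L \<phi>"

fun term_vars :: "'f fo_term \<Rightarrow> nat set" where
  "term_vars (Var i) = {i}"
| "term_vars (Fun g ts) = (\<Union>t\<in>set ts. term_vars t)"

fun free_vars :: "('f, 'r) formula \<Rightarrow> nat set" where
  "free_vars (Eq s t) = term_vars s \<union> term_vars t"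
| "free_vars (Rel r ts) = (\<Union>t\<in>set ts. term_vars t)"
| "free_vars (Neg \<phi>) = free_vars \<phi>"
| "free_vars (Conj \<phi> \<psi>) = free_vars \<phi> \<union> free_vars \<psi>"
| "free_vars (Ex i \<phi>) = free_vars \<phi> - {i}"

definition sentence :: "('f, 'r) language \<Rightarrow> ('f, 'r) formula \<Rightarrow> bool" where
  "sentence L \<phi> \<longleftrightarrow> is_formula L \<phi> \<and> free_vars \<phi> = {}"

record ('f, 'r, 'u) fo_struct =
  univ :: "'u set"
  fun_interp :: "'f \<Rightarrow> 'u list \<Rightarrow> 'u"
  rel_interp :: "'r \<Rightarrow> 'u list set"

definition is_struct :: "('f, 'r) language \<Rightarrow> ('f, 'r, 'u) fo_struct \<Rightarrow> bool" where
  "is_struct L M \<longleftrightarrow> univ M \<noteq> {} \<and>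
     (\<forall>g\<in>fun_syms L. \<forall>as. length as = fun_arity L g \<and> set as \<subseteq> univ M
        \<longrightarrow> fun_interp M g as \<in> univ M)"

fun eval_term :: "('f, 'r, 'u) fo_struct \<Rightarrow> (nat \<Rightarrow> 'u) \<Rightarrow> 'f fo_term \<Rightarrow> 'u" where
  "eval_term M s (Var i) = s i"
| "eval_term M s (Fun g ts) = fun_interp M g (map (eval_term M s) ts)"

fun sat :: "('f, 'r, 'u) fo_struct \<Rightarrow> (nat \<Rightarrow> 'u) \<Rightarrow> ('f, 'r) formula \<Rightarrow> bool" where
  "sat M s (Eq t u) \<longleftrightarrow> eval_term M s t = eval_term M s u"
| "sat M s (Rel r ts) \<longleftrightarrow> map (eval_term M s) ts \<in> rel_interp M r"
| "sat M s (Neg \<phi>) \<longleftrightarrow> \<not> sat M s \<phi>"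
| "sat M s (Conj \<phi> \<psi>) \<longleftrightarrow> sat M s \<phi> \<and> sat M s \<psi>"
| "sat M s (Ex i \<phi>) \<longleftrightarrow> (\<exists>a\<in>univ M. sat M (s(i := a)) \<phi>)"

definition is_model :: "('f, 'r) language \<Rightarrow> ('f, 'r) formula set \<Rightarrow> ('f, 'r, 'u) fo_struct \<Rightarrow> bool"
  where "is_model L T M \<longleftrightarrow> is_struct L M \<and>
     (\<forall>\<phi>\<in>T. \<forall>s. range s \<subseteq> univ M \<longrightarrow> sat M s \<phi>)"

text \<open>A formula of HOL cannot quantify over all types of possible elements of models. For
  satisfiability and entailment of sentences this is harmless: by the downward
  Loewenheim-Skolem theorem it suffices to consider models whose elements are drawn from one
  type of cardinality at least \<open>|L| + \<aleph>\<^sub>0\<close>, such as the type of formulas.\<close>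

definition satisfiable :: "('f, 'r) language \<Rightarrow> ('f, 'r) formula set \<Rightarrow> bool" where
  "satisfiable L T \<longleftrightarrow> (\<exists>N :: ('f, 'r, ('f, 'r) formula) fo_struct. is_model L T N)"

definition entails :: "('f, 'r) language \<Rightarrow> ('f, 'r) formula set \<Rightarrow> ('f, 'r) formula \<Rightarrow> bool" where
  "entails L T \<phi> \<longleftrightarrow>
     (\<forall>N :: ('f, 'r, ('f, 'r) formula) fo_struct. is_model L T N \<longrightarrow> is_model L {\<phi>} N)"

definition complete_theory :: "('f, 'r) language \<Rightarrow> ('f, 'r) formula set \<Rightarrow> bool" where
  "complete_theory L T \<longleftrightarrow> (\<forall>\<phi>\<in>T. sentence L \<phi>) \<and> satisfiable L T \<and>
     (\<forall>\<phi>. sentence L \<phi> \<longrightarrow> entails L T \<phi> \<or> entails L T (Neg \<phi>))"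


section \<open>Definable sets and functions\<close>

text \<open>The power \<open>M\<^sup>n\<close> consists of extensional functions on \<open>{..<n}\<close>, so that it is the underlying
  set of the library's product topology, and \<open>M\<^sup>0\<close> is a point.\<close>

abbreviation tuples :: "'u set \<Rightarrow> nat \<Rightarrow> (nat \<Rightarrow> 'u) set" where
  "tuples A n \<equiv> {..<n} \<rightarrow>\<^sub>E A"

text \<open>The tuple \<open>x\<close> of length \<open>n\<close> followed by \<open>e\<close>. In \<open>sat M (prepend n x e) \<phi>\<close> the variables
  \<open>0, \<dots>, n - 1\<close> of \<open>\<phi>\<close> denote \<open>x\<close> and the remaining ones denote parameters; only the finitely
  many entries of \<open>e\<close> at free variables of \<open>\<phi>\<close> matter.\<close>

definition prepend :: "nat \<Rightarrow> (nat \<Rightarrow> 'u) \<Rightarrow> (nat \<Rightarrow> 'u) \<Rightarrow> nat \<Rightarrow> 'u" where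
  "prepend n x e = (\<lambda>i. if i < n then x i else e (i - n))"

definition definable ::
    "('f, 'r) language \<Rightarrow> ('f, 'r, 'u) fo_struct \<Rightarrow> nat \<Rightarrow> (nat \<Rightarrow> 'u) set \<Rightarrow> bool" where
  "definable L M n X \<longleftrightarrow>
     (\<exists>\<phi> e. is_formula L \<phi> \<and> range e \<subseteq> univ M \<and>
        X = {x \<in> tuples (univ M) n. sat M (prepend n x e) \<phi>})"

definition graph_on ::
    "nat \<Rightarrow> nat \<Rightarrow> (nat \<Rightarrow> 'u) set \<Rightarrow> ((nat \<Rightarrow> 'u) \<Rightarrow> nat \<Rightarrow> 'u) \<Rightarrow> (nat \<Rightarrow> 'u) set" where
  "graph_on m n X f = (\<lambda>x. restrict (prepend m x (f x)) {..<m + n}) ` X"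

text \<open>\<open>f\<close> is a definable function from \<open>X \<subseteq> M\<^sup>m\<close> to \<open>Y \<subseteq> M\<^sup>n\<close>; its values outside \<open>X\<close> are
  irrelevant.\<close>

definition definable_map ::
    "('f, 'r) language \<Rightarrow> ('f, 'r, 'u) fo_struct \<Rightarrow> nat \<Rightarrow> (nat \<Rightarrow> 'u) set \<Rightarrow>
     nat \<Rightarrow> (nat \<Rightarrow> 'u) set \<Rightarrow> ((nat \<Rightarrow> 'u) \<Rightarrow> nat \<Rightarrow> 'u) \<Rightarrow> bool" where
  "definable_map L M m X n Y f \<longleftrightarrow>
     X \<subseteq> tuples (univ M) m \<and> Y \<subseteq> tuples (univ M) n \<and> f \<in> X \<rightarrow> Y \<and>
     definable L M (m + n) (graph_on m n X f)"

text \<open>Every set of formulas in finitely many variables, with parameters from a finite set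
  \<open>range e\<close>, that is finitely satisfiable in \<open>M\<close> is realized in \<open>M\<close>.\<close>

definition omega_saturated :: "('f, 'r) language \<Rightarrow> ('f, 'r, 'u) fo_struct \<Rightarrow> bool" where
  "omega_saturated L M \<longleftrightarrow>
     (\<forall>n e p. range e \<subseteq> univ M \<and> finite (range e) \<and> (\<forall>\<phi>\<in>p. is_formula L \<phi>) \<and>
        (\<forall>q\<subseteq>p. finite q \<longrightarrow> (\<exists>x\<in>tuples (univ M) n. \<forall>\<phi>\<in>q. sat M (prepend n x e) \<phi>))
        \<longrightarrow> (\<exists>x\<in>tuples (univ M) n. \<forall>\<phi>\<in>p. sat M (prepend n x e) \<phi>))"


section \<open>Uniform structures\<close>

definition uniform_base :: "'u set \<Rightarrow> ('u \<times> 'u) set set \<Rightarrow> bool" where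
  "uniform_base A B \<longleftrightarrow> B \<noteq> {} \<and> (\<forall>D\<in>B. D \<subseteq> A \<times> A) \<and>
     (\<forall>D1\<in>B. \<forall>D2\<in>B. \<exists>E\<in>B. E \<subseteq> D1 \<inter> D2) \<and>
     (\<forall>D\<in>B. Id_on A \<subseteq> D) \<and>
     (\<forall>D\<in>B. \<exists>E\<in>B. E \<subseteq> D\<inverse>) \<and>
     (\<forall>D\<in>B. \<exists>E\<in>B. E O E \<subseteq> D)"

text \<open>The balls \<open>D `` {x}\<close> are the basic neighbourhoods of \<open>x\<close>; they need not be open
  themselves.\<close>

definition uniform_topology :: "'u set \<Rightarrow> ('u \<times> 'u) set set \<Rightarrow> 'u topology" where
  "uniform_topology A B = topology (\<lambda>U. U \<subseteq> A \<and> (\<forall>x\<in>U. \<exists>D\<in>B. D `` {x} \<subseteq> U))"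

lemma openin_uniform_topology:
  assumes "uniform_base A B"
  shows "openin (uniform_topology A B) U \<longleftrightarrow> U \<subseteq> A \<and> (\<forall>x\<in>U. \<exists>D\<in>B. D `` {x} \<subseteq> U)"
proof -
  define P where "P = (\<lambda>U. U \<subseteq> A \<and> (\<forall>x\<in>U. \<exists>D\<in>B. D `` {x} \<subseteq> U))"
  have "P (S \<inter> S')" if S: "P S" and S': "P S'" for S S'
    unfolding P_def
  proof (rule conjI, goal_cases)
    case 1
    then show ?case using S by (auto simp: P_def)
  next
    case 2
    show ?case
    proof
      fix x assume x: "x \<in> S \<inter> S'"
      obtain D1 where D1: "D1 \<in> B" "D1 `` {x} \<subseteq> S"
        using S x by (auto simp: P_def)
      obtain D2 where D2: "D2 \<in> B" "D2 `` {x} \<subseteq> S'"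
        using S' x by (auto simp: P_def)
      have "\<exists>E\<in>B. E \<subseteq> D1 \<inter> D2"
        using assms D1(1) D2(1) by (simp add: uniform_base_def)
      then obtain E where E: "E \<in> B" "E \<subseteq> D1 \<inter> D2" ..
      then have "E `` {x} \<subseteq> D1 `` {x} \<inter> D2 `` {x}" by (auto simp: Image_def)
      then show "\<exists>D\<in>B. D `` {x} \<subseteq> S \<inter> S'"
        using D1(2) D2(2) E(1) by (intro bexI[of _ E]) auto
    qed
  qed
  moreover have "P (\<Union>K)" if K: "\<forall>S\<in>K. P S" for K
    unfolding P_def
  proof (rule conjI, goal_cases)
    case 1
    then show ?case using K by (auto simp: P_def)
  next
    case 2
    show ?case
    proof
      fix x assume "x \<in> \<Union>K"
      then obtain S where S: "S \<in> K" "x \<in> S" ..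
      moreover from K S(1) have "P S" ..
      ultimately obtain D where "D \<in> B" "D `` {x} \<subseteq> S"
        by (auto simp: P_def)
      then show "\<exists>D\<in>B. D `` {x} \<subseteq> \<Union>K" using S by (intro bexI[of _ D]) auto
    qed
  qed
  ultimately have "istopology P"
    by (simp add: istopology_def)
  then have "openin (uniform_topology A B) U \<longleftrightarrow> P U"
    unfolding uniform_topology_def P_def by (simp only: topology_inverse')
  then show ?thesis
    by (simp only: P_def)
qed

lemma topspace_uniform_topology:
  assumes "uniform_base A B"
  shows "topspace (uniform_topology A B) = A"
proof
  show "topspace (uniform_topology A B) \<subseteq> A"
    using openin_topspace[of "uniform_topology A B"]
    unfolding openin_uniform_topology[OF assms] by (rule conjunct1)
  obtain D where D: "D \<in> B" "D \<subseteq> A \<times> A"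
    using assms by (auto simp: uniform_base_def)
  then have "\<forall>x\<in>A. D `` {x} \<subseteq> A" by auto
  then have "openin (uniform_topology A B) A"
    unfolding openin_uniform_topology[OF assms] using D(1) by auto
  then show "A \<subseteq> topspace (uniform_topology A B)"
    by (rule openin_subset)
qed

definition power_topology :: "'u topology \<Rightarrow> nat \<Rightarrow> (nat \<Rightarrow> 'u) topology" where
  "power_topology \<tau> n = product_topology (\<lambda>_. \<tau>) {..<n}"

text \<open>The family \<open>{\<phi>(M\<^sup>2; b) : M \<Turnstile> \<psi>(b)}\<close>: the variables \<open>0\<close>, \<open>1\<close> of \<open>\<phi>\<close> are the two
  coordinates, and variable \<open>i + 2\<close> of \<open>\<phi>\<close> and variable \<open>i\<close> of \<open>\<psi>\<close> denote the entry \<open>b i\<close>.\<close>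

definition def_family ::
    "('f, 'r, 'u) fo_struct \<Rightarrow> ('f, 'r) formula \<Rightarrow> ('f, 'r) formula \<Rightarrow> ('u \<times> 'u) set set" where
  "def_family M \<phi> \<psi> =
     {{(x, y) \<in> univ M \<times> univ M. sat M (case_nat x (case_nat y b)) \<phi>} | b.
        range b \<subseteq> univ M \<and> sat M b \<psi>}"

definition definable_uniform_structure ::
    "('f, 'r) language \<Rightarrow> ('f, 'r, 'u) fo_struct \<Rightarrow> ('f, 'r) formula \<Rightarrow> ('f, 'r) formula \<Rightarrow> bool"
  where "definable_uniform_structure L M \<phi> \<psi> \<longleftrightarrow> is_formula L \<phi> \<and> is_formula L \<psi> \<and>
     uniform_base (univ M) (def_family M \<phi> \<psi>) \<and> (\<forall>D\<in>def_family M \<phi> \<psi>. D\<inverse> = D)"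

definition def_topology ::
    "('f, 'r, 'u) fo_struct \<Rightarrow> ('f, 'r) formula \<Rightarrow> ('f, 'r) formula \<Rightarrow> 'u topology" where
  "def_topology M \<phi> \<psi> = uniform_topology (univ M) (def_family M \<phi> \<psi>)"

definition visceral ::
    "('f, 'r) language \<Rightarrow> ('f, 'r, 'u) fo_struct \<Rightarrow> ('f, 'r) formula \<Rightarrow> ('f, 'r) formula \<Rightarrow> bool"
  where "visceral L M \<phi> \<psi> \<longleftrightarrow> definable_uniform_structure L M \<phi> \<psi> \<and>
     (\<forall>D\<in>def_family M \<phi> \<psi>. \<forall>x\<in>univ M. \<exists>E\<in>def_family M \<phi> \<psi>. E `` {x} \<subset> D `` {x}) \<and>
     (\<forall>A\<subseteq>univ M. infinite A \<and> definable L M 1 {x \<in> tuples (univ M) 1. x 0 \<in> A}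
        \<longrightarrow> def_topology M \<phi> \<psi> interior_of A \<noteq> {})"


section \<open>Properties of theories\<close>

text \<open>The following properties quantify over models with elements in a type \<open>'u\<close>. If \<open>T\<close> is
  complete and has an \<open>\<omega>\<close>-saturated model in \<open>'u\<close>, then definable finite choice and the absence
  of space-filling functions do not depend on \<open>'u\<close>: the latter is expressed by sentences, and
  the former holds in all \<open>\<omega>\<close>-saturated models of \<open>T\<close> as soon as it holds in one.\<close>

definition visceral_theory ::
    "'u itself \<Rightarrow> ('f, 'r) language \<Rightarrow> ('f, 'r) formula set \<Rightarrow> bool" where
  "visceral_theory (_ :: 'u itself) L T \<longleftrightarrow>
     (\<exists>(N :: ('f, 'r, 'u) fo_struct) \<phi> \<psi>.
        is_model L T N \<and> omega_saturated L N \<and> visceral L N \<phi> \<psi>)"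

definition definable_finite_choice ::
    "'u itself \<Rightarrow> ('f, 'r) language \<Rightarrow> ('f, 'r) formula set \<Rightarrow> bool" where
  "definable_finite_choice (_ :: 'u itself) L T \<longleftrightarrow>
     (\<forall>(N :: ('f, 'r, 'u) fo_struct) m n X f.
        is_model L T N \<and> omega_saturated L N \<and>
        definable_map L N m X n (tuples (univ N) n) f \<and>
        (\<forall>y\<in>f ` X. finite {x \<in> X. f x = y})
        \<longrightarrow> (\<exists>\<sigma>. definable_map L N n (f ` X) m X \<sigma> \<and> (\<forall>y\<in>f ` X. f (\<sigma> y) = y)))"

definition no_space_filling ::
    "'u itself \<Rightarrow> ('f, 'r) language \<Rightarrow> ('f, 'r) formula set \<Rightarrow>
     ('f, 'r) formula \<Rightarrow> ('f, 'r) formula \<Rightarrow> bool" where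
  "no_space_filling (_ :: 'u itself) L T \<phi> \<psi> \<longleftrightarrow>
     \<not> (\<exists>(N :: ('f, 'r, 'u) fo_struct) m n X Y f.
        is_model L T N \<and> m < n \<and> definable_map L N m X n Y f \<and> f ` X = Y \<and>
        power_topology (def_topology N \<phi> \<psi>) n interior_of Y \<noteq> {})"


section \<open>Dimension\<close>

definition coord_proj :: "nat \<Rightarrow> (nat \<Rightarrow> nat) \<Rightarrow> (nat \<Rightarrow> 'u) \<Rightarrow> nat \<Rightarrow> 'u" where
  "coord_proj k \<iota> x = restrict (x \<circ> \<iota>) {..<k}"

definition has_open_proj :: "'u topology \<Rightarrow> nat \<Rightarrow> (nat \<Rightarrow> 'u) set \<Rightarrow> nat \<Rightarrow> bool" where
  "has_open_proj \<tau> n X k \<longleftrightarrow>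
     (\<exists>\<iota>. strict_mono_on {..<k} \<iota> \<and> \<iota> ` {..<k} \<subseteq> {..<n} \<and>
        power_topology \<tau> k interior_of (coord_proj k \<iota> ` X) \<noteq> {})"

text \<open>The empty set, for which no \<open>k\<close> qualifies, gets dimension \<open>-1\<close>; for nonempty \<open>X\<close> the
  value \<open>k = 0\<close> always qualifies.\<close>

definition top_dim :: "'u topology \<Rightarrow> nat \<Rightarrow> (nat \<Rightarrow> 'u) set \<Rightarrow> int" where
  "top_dim \<tau> n X =
     (if X = {} then - 1 else int (GREATEST k. k \<le> n \<and> has_open_proj \<tau> n X k))"

end

theory Submission
  imports Defs
begin

text \<open>A base index \<open>b\<close>, a centre \<open>w\<close> and a number \<open>k\<close> of coordinates determine a box of \<open>M\<^sup>k\<close>.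
  By saturation, a definable family of finite subsets of \<open>M\<close> has bounded cardinality. If
  \<open>A \<subseteq> M\<^sup>k \<times> M\<close> is definable without interior, then, for every box of \<open>M\<^sup>k\<close>, only finitely many
  fibres \<open>A\<^sub>t \<subseteq> M\<^sup>k\<close> contain it, because an infinite definable set of such \<open>t\<close> would contain a ball;
  their number is therefore bounded independently of the box. Two consequences:

  \<^item> If \<open>A \<union> A'\<close> has interior, then so has \<open>A\<close> or \<open>A'\<close>: otherwise shrink the box successively so that
  it lies in \<open>A\<^sub>t\<close> or in \<open>A'\<^sub>t\<close> for more values of \<open>t\<close> than the two bounds allow.

  \<^item> A definable set without interior is a finite union of definable sets, each of which has finite
  fibres over the projection that forgets one coordinate.

  Let \<open>R\<close> be a definable function from a subset of \<open>M\<^sup>n\<close> onto a subset of \<open>M\<^sup>k\<close> with interior. If its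
  domain has interior, then \<open>k \<le> n\<close> as there are no space-filling functions. If not, the two facts
  above and definable finite choice yield a piece of the domain which still has an image with interior
  and on which forgetting some coordinate is injective. By induction on \<open>n\<close>, some coordinate
  projection of the domain to \<open>M\<^bsup>k'\<^esup>\<close> with \<open>k' \<ge> k\<close> has interior. For a bijection \<open>f : X \<rightarrow> Y\<close> this is
  applied to a coordinate projection of \<open>X\<close> composed with the inverse of \<open>f\<close>, and conversely.\<close>


section \<open>Definable predicates\<close>

lemma finite_term_vars: "finite (term_vars t)"
  by (induction t) auto

lemma finite_free_vars: "finite (free_vars \<phi>)"
  by (induction \<phi>) (auto simp: finite_term_vars)

lemma eval_term_cong: "(\<And>i. i \<in> term_vars t \<Longrightarrow> s i = s' i) \<Longrightarrow> eval_term M s t = eval_term M s' t"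
proof (induction t)
  case (Fun g ts)
  have "eval_term M s t = eval_term M s' t" if "t \<in> set ts" for t
    by (rule Fun.IH[OF that], rule Fun.prems) (use that in auto)
  then have "map (eval_term M s) ts = map (eval_term M s') ts" by simp
  then show ?case by (simp only: eval_term.simps)
qed simp

lemma sat_cong: "(\<And>i. i \<in> free_vars \<phi> \<Longrightarrow> s i = s' i) \<Longrightarrow> sat M s \<phi> \<longleftrightarrow> sat M s' \<phi>"
proof (induction \<phi> arbitrary: s s')
  case (Eq t u)
  have "eval_term M s t = eval_term M s' t" "eval_term M s u = eval_term M s' u"
    by (rule eval_term_cong, rule Eq.prems, simp)+
  then show ?case by simp
next
  case (Rel r ts)
  have "eval_term M s t = eval_term M s' t" if "t \<in> set ts" for t
    by (rule eval_term_cong, rule Rel) (use that in auto)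
  then have "map (eval_term M s) ts = map (eval_term M s') ts" by simp
  then show ?case by (simp only: sat.simps)
next
  case (Neg \<phi>)
  have "sat M s \<phi> = sat M s' \<phi>"
    by (rule Neg.IH, rule Neg.prems) simp
  then show ?case by simp
next
  case (Conj \<phi>1 \<phi>2)
  have "sat M s \<phi>1 = sat M s' \<phi>1"
    by (rule Conj.IH(1), rule Conj.prems) simp
  moreover have "sat M s \<phi>2 = sat M s' \<phi>2"
    by (rule Conj.IH(2), rule Conj.prems) simp
  ultimately show ?case by simp
next
  case (Ex i \<phi>)
  have "sat M (s(i := a)) \<phi> = sat M (s'(i := a)) \<phi>" for a
    using Ex.prems by (intro Ex.IH) auto
  then show ?case by simp
qed

primrec rename_term :: "(nat \<Rightarrow> nat) \<Rightarrow> 'f fo_term \<Rightarrow> 'f fo_term" where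
  "rename_term \<rho> (Var i) = Var (\<rho> i)"
| "rename_term \<rho> (Fun g ts) = Fun g (map (rename_term \<rho>) ts)"

lemma eval_rename_term: "eval_term M s (rename_term \<rho> t) = eval_term M (\<lambda>i. s (\<rho> i)) t"
proof (induction t)
  case (Fun g ts)
  then have "map (eval_term M s \<circ> rename_term \<rho>) ts = map (eval_term M (\<lambda>i. s (\<rho> i))) ts" by simp
  then show ?case by (simp del: map_eq_conv)
qed simp

lemma is_term_rename_term: "is_term L t \<Longrightarrow> is_term L (rename_term \<rho> t)"
  by (induction t) auto

text \<open>\<open>\<rho>\<close> need not be injective and may send a free variable to the name of
  a bound one, so bound variables have to change. An existence statement avoids fixing a
  capture-avoiding substitution.\<close>

lemma rename_formula:
  "is_formula L \<phi> \<Longrightarrow> \<exists>\<phi>'. is_formula L \<phi>' \<and> (\<forall>s. sat M s \<phi>' \<longleftrightarrow> sat M (\<lambda>i. s (\<rho> i)) \<phi>)"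
proof (induction \<phi> arbitrary: \<rho>)
  case (Eq t u)
  then show ?case
    by (intro exI[of _ "Eq (rename_term \<rho> t) (rename_term \<rho> u)"])
       (simp add: is_term_rename_term eval_rename_term)
next
  case (Rel r ts)
  have "map (eval_term M s) (map (rename_term \<rho>) ts) = map (eval_term M (\<lambda>i. s (\<rho> i))) ts" for s
    by (simp add: eval_rename_term)
  then have "sat M s (Rel r (map (rename_term \<rho>) ts)) \<longleftrightarrow> sat M (\<lambda>i. s (\<rho> i)) (Rel r ts)" for s
    by (simp only: sat.simps)
  moreover have "is_formula L (Rel r (map (rename_term \<rho>) ts))"
    using Rel by (simp add: is_term_rename_term)
  ultimately show ?case by blast
next
  case (Neg \<phi>)
  from Neg.prems have "is_formula L \<phi>" by simp
  from Neg.IH[OF this] obtain \<phi>' where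
    "is_formula L \<phi>'" "\<forall>s. sat M s \<phi>' \<longleftrightarrow> sat M (\<lambda>i. s (\<rho> i)) \<phi>" by blast
  then show ?case by (intro exI[of _ "Neg \<phi>'"]) simp
next
  case (Conj \<phi>1 \<phi>2)
  from Conj.prems have p: "is_formula L \<phi>1" "is_formula L \<phi>2" by simp_all
  from Conj.IH(1)[OF p(1)] obtain \<phi>1' where 1:
    "is_formula L \<phi>1'" "\<forall>s. sat M s \<phi>1' \<longleftrightarrow> sat M (\<lambda>i. s (\<rho> i)) \<phi>1" by blast
  from Conj.IH(2)[OF p(2)] obtain \<phi>2' where 2:
    "is_formula L \<phi>2'" "\<forall>s. sat M s \<phi>2' \<longleftrightarrow> sat M (\<lambda>i. s (\<rho> i)) \<phi>2" by blast
  show ?case using 1 2 by (intro exI[of _ "Conj \<phi>1' \<phi>2'"]) simp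
next
  case (Ex i \<phi>)
  \<comment> \<open>\<open>j\<close> is not the image of a free variable, so binding
    \<open>j\<close> in place of \<open>i\<close> captures nothing.\<close>
  have "finite (\<rho> ` free_vars \<phi>)" by (simp add: finite_free_vars)
  then obtain j where j: "j \<notin> \<rho> ` free_vars \<phi>" using ex_new_if_finite infinite_UNIV_nat by blast
  from Ex.prems have "is_formula L \<phi>" by simp
  from Ex.IH[OF this, of "\<rho>(i := j)"] obtain \<phi>' where \<phi>': "is_formula L \<phi>'"
    "\<And>s. sat M s \<phi>' \<longleftrightarrow> sat M (\<lambda>k. s ((\<rho>(i := j)) k)) \<phi>"
    by blast
  have *: "sat M (\<lambda>k. (s(j := a)) ((\<rho>(i := j)) k)) \<phi> \<longleftrightarrow> sat M ((\<lambda>i. s (\<rho> i))(i := a)) \<phi>" for s a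
    by (rule sat_cong) (use j in auto)
  have "sat M s (Ex j \<phi>') \<longleftrightarrow> sat M (\<lambda>i. s (\<rho> i)) (Ex i \<phi>)" for s
    by (simp only: sat.simps \<phi>'(2) *)
  then show ?case using \<phi>'(1) by (intro exI[of _ "Ex j \<phi>'"]) simp
qed


section \<open>Definable predicates and their closure properties\<close>

locale nonempty_structure =
  fixes L :: "('f, 'r) language" and M :: "('f, 'r, 'u) fo_struct"
  assumes univ_nonempty: "univ M \<noteq> {}"
begin

definition u0 :: 'u where "u0 = (SOME u. u \<in> univ M)"

lemma u0: "u0 \<in> univ M"
  using univ_nonempty unfolding u0_def by (metis ex_in_conv someI_ex)

text \<open>Tuples are represented by infinite sequences in \<open>M\<close>, of which a formula reads only finitely many
  entries; thus a single quantifier over sequences serves for all arities and for the parameters of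
  the uniform structure.\<close>

definition assignments :: "(nat \<Rightarrow> 'u) set" where "assignments = {s. range s \<subseteq> univ M}"

lemma assignments_app: "s \<in> assignments \<Longrightarrow> s i \<in> univ M" by (auto simp: assignments_def)
lemma assignments_upd: "s \<in> assignments \<Longrightarrow> a \<in> univ M \<Longrightarrow> s(i := a) \<in> assignments" by (auto simp: assignments_def)
lemma assignmentsI: "(\<And>i. s i \<in> univ M) \<Longrightarrow> s \<in> assignments" by (auto simp: assignments_def)

text \<open>Here \<open>C\<close> is the set of functions from the environment type \<open>'a\<close> to \<open>M\<close> that may be substituted for
  the free variables of a formula. Parameters are allowed by having constant functions in \<open>C\<close>; the
  constant \<open>u0\<close> is always allowed, so that there is something to substitute for unused variables.\<close>

definition definable_pred :: "('a \<Rightarrow> 'u) set \<Rightarrow> ('a \<Rightarrow> bool) \<Rightarrow> bool" where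
  "definable_pred C Q \<longleftrightarrow> (\<exists>\<phi> \<rho>. is_formula L \<phi> \<and> range \<rho> \<subseteq> insert (\<lambda>_. u0) C \<and>
     (\<forall>x. Q x \<longleftrightarrow> sat M (\<lambda>i. \<rho> i x) \<phi>))"

lemma definable_predI: "is_formula L \<phi> \<Longrightarrow> (\<And>i. \<rho> i \<in> insert (\<lambda>_. u0) C) \<Longrightarrow>
    (\<And>x. Q x \<longleftrightarrow> sat M (\<lambda>i. \<rho> i x) \<phi>) \<Longrightarrow> definable_pred C Q"
  unfolding definable_pred_def by (intro exI[of _ \<phi>] exI[of _ \<rho>] conjI allI image_subsetI) simp_all

lemma definable_predE:
  assumes "definable_pred C Q"
  obtains \<phi> \<rho> where "is_formula L \<phi>" "\<And>i. \<rho> i \<in> insert (\<lambda>_. u0) C"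
    "\<And>x. Q x \<longleftrightarrow> sat M (\<lambda>i. \<rho> i x) \<phi>"
proof -
  from assms obtain \<phi> \<rho> where 1: "is_formula L \<phi>" "range \<rho> \<subseteq> insert (\<lambda>_. u0) C"
    "\<forall>x. Q x \<longleftrightarrow> sat M (\<lambda>i. \<rho> i x) \<phi>" unfolding definable_pred_def by blast
  show ?thesis
  proof (rule that)
    show "is_formula L \<phi>" by (rule 1(1))
    show "\<rho> i \<in> insert (\<lambda>_. u0) C" for i by (rule subsetD[OF 1(2) rangeI])
    show "Q x \<longleftrightarrow> sat M (\<lambda>i. \<rho> i x) \<phi>" for x by (rule spec[OF 1(3)])
  qed
qed

lemma definable_pred_not:
  assumes "definable_pred C P"
  shows "definable_pred C (\<lambda>x. \<not> P x)"
proof -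
  from assms obtain \<phi> \<rho> where 1: "is_formula L \<phi>" "\<And>i. \<rho> i \<in> insert (\<lambda>_. u0) C"
    "\<And>x. P x \<longleftrightarrow> sat M (\<lambda>i. \<rho> i x) \<phi>" by (rule definable_predE) (rule that; simp)
  show ?thesis by (rule definable_predI[of "Neg \<phi>", OF _ 1(2)]) (simp_all add: 1(1,3))
qed

lemma definable_pred_conj:
  assumes "definable_pred C P" "definable_pred C Q"
  shows "definable_pred C (\<lambda>x. P x \<and> Q x)"
proof -
  from assms(1) obtain \<phi> \<rho> where 1: "is_formula L \<phi>" "\<And>i. \<rho> i \<in> insert (\<lambda>_. u0) C"
    "\<And>x. P x \<longleftrightarrow> sat M (\<lambda>i. \<rho> i x) \<phi>" by (rule definable_predE) (rule that; simp)
  from assms(2) obtain \<phi>' \<rho>' where 2: "is_formula L \<phi>'" "\<And>i. \<rho>' i \<in> insert (\<lambda>_. u0) C"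
    "\<And>x. Q x \<longleftrightarrow> sat M (\<lambda>i. \<rho>' i x) \<phi>'" by (rule definable_predE) (rule that; simp)
  \<comment> \<open>The two formulas are moved to even and odd variables, so that a single
    substitution serves both.\<close>
  obtain \<theta> where 3: "is_formula L \<theta>" "\<And>s. sat M s \<theta> \<longleftrightarrow> sat M (\<lambda>i. s (2 * i)) \<phi>"
    using rename_formula[OF 1(1), where M = M and \<rho> = "\<lambda>i. 2 * i"] by blast
  obtain \<theta>' where 4: "is_formula L \<theta>'" "\<And>s. sat M s \<theta>' \<longleftrightarrow> sat M (\<lambda>i. s (2 * i + 1)) \<phi>'"
    using rename_formula[OF 2(1), where M = M and \<rho> = "\<lambda>i. 2 * i + 1"] by blast
  show ?thesis
  proof (rule definable_predI)
    show "is_formula L (Conj \<theta> \<theta>')" using 3 4 by simp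
    show "(if even i then \<rho> (i div 2) else \<rho>' (i div 2)) \<in> insert (\<lambda>_. u0) C" for i
      using 1(2)[of "i div 2"] 2(2)[of "i div 2"] by simp
    show "P x \<and> Q x \<longleftrightarrow>
        sat M (\<lambda>i. (if even i then \<rho> (i div 2) else \<rho>' (i div 2)) x) (Conj \<theta> \<theta>')" for x
      unfolding sat.simps 1(3) 2(3) 3(2) 4(2) by simp
  qed
qed

lemma definable_pred_disj:
  assumes "definable_pred C P" "definable_pred C Q"
  shows "definable_pred C (\<lambda>x. P x \<or> Q x)"
proof -
  have "definable_pred C (\<lambda>x. \<not> (\<not> P x \<and> \<not> Q x))" by (intro definable_pred_not definable_pred_conj assms)
  then show ?thesis by (simp only: de_Morgan_conj not_not)
qed

lemma definable_pred_imp: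
  assumes "definable_pred C P" "definable_pred C Q"
  shows "definable_pred C (\<lambda>x. P x \<longrightarrow> Q x)"
proof -
  have "definable_pred C (\<lambda>x. \<not> P x \<or> Q x)" by (intro definable_pred_not definable_pred_disj assms)
  then show ?thesis by (simp only: imp_conv_disj)
qed

lemma definable_pred_eq: "f \<in> C \<Longrightarrow> g \<in> C \<Longrightarrow> definable_pred C (\<lambda>x. f x = g x)"
  by (rule definable_predI[of "Eq (Var 0) (Var 1)" "\<lambda>i. if i = 0 then f else g"]) auto

lemma definable_pred_True: "definable_pred C (\<lambda>x. True)"
  by (rule definable_predI[of "Eq (Var 0) (Var 0)" "\<lambda>i. \<lambda>_. u0"]) auto

lemma definable_pred_const: "definable_pred C (\<lambda>x. P)"
proof (cases P)
  case True
  then show ?thesis by (simp only: definable_pred_True)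
next
  case False
  have "definable_pred C (\<lambda>x. \<not> True)" by (intro definable_pred_not definable_pred_True)
  with False show ?thesis by simp
qed

lemma definable_pred_ball_finite: "finite A \<Longrightarrow> (\<And>a. a \<in> A \<Longrightarrow> definable_pred C (\<lambda>x. P x a)) \<Longrightarrow> definable_pred C (\<lambda>x. \<forall>a\<in>A. P x a)"
proof (induction A rule: finite_induct)
  case (insert a A)
  then have "definable_pred C (\<lambda>x. P x a \<and> (\<forall>a\<in>A. P x a))" by (intro definable_pred_conj) auto
  then show ?case by simp
qed (simp add: definable_pred_True)

lemma definable_pred_all_less: "(\<And>i. i < (k::nat) \<Longrightarrow> definable_pred C (\<lambda>x. P x i)) \<Longrightarrow> definable_pred C (\<lambda>x. \<forall>i<k. P x i)"
  using definable_pred_ball_finite[of "{..<k}" C P] by (simp add: Ball_def)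

lemma definable_pred_subst:
  assumes "definable_pred C P" "\<And>f. f \<in> C \<Longrightarrow> (\<lambda>x. f (g x)) \<in> C'"
  shows "definable_pred C' (\<lambda>x. P (g x))"
proof -
  from assms(1) obtain \<phi> \<rho> where 1: "is_formula L \<phi>" "\<And>i. \<rho> i \<in> insert (\<lambda>_. u0) C"
    "\<And>x. P x \<longleftrightarrow> sat M (\<lambda>i. \<rho> i x) \<phi>" by (rule definable_predE) (rule that; simp)
  show ?thesis
  proof (rule definable_predI[OF 1(1)])
    show "(\<lambda>x. \<rho> i (g x)) \<in> insert (\<lambda>_. u0) C'" for i
      using 1(2)[of i] assms(2)[of "\<rho> i"] by auto
  qed (rule 1(3))
qed

lemma definable_pred_mono: "definable_pred C P \<Longrightarrow> C \<subseteq> C' \<Longrightarrow> definable_pred C' P"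
  using definable_pred_subst[of C P "\<lambda>x. x" C'] by auto

lemma definable_pred_sat:
  assumes "is_formula L \<phi>" "\<And>i. (\<lambda>x. h x i) \<in> C"
  shows "definable_pred C (\<lambda>x. sat M (h x) \<phi>)"
  by (rule definable_predI[OF assms(1), of "\<lambda>i x. h x i"]) (use assms(2) in auto)

text \<open>A formula has finitely many free variables; all others may be sent to \<open>u0\<close>.
  This makes saturation, which concerns finitely many variables and parameters, applicable to
  predicates on infinite sequences.\<close>

lemma definable_pred_finite_coords:
  assumes "definable_pred C P"
  shows "\<exists>C0. finite C0 \<and> C0 \<subseteq> C \<and> definable_pred C0 P"
proof -
  from assms(1) obtain \<phi> \<rho> where 1: "is_formula L \<phi>" "\<And>i. \<rho> i \<in> insert (\<lambda>_. u0) C"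
    "\<And>x. P x \<longleftrightarrow> sat M (\<lambda>i. \<rho> i x) \<phi>" by (rule definable_predE) (rule that; simp)
  define C0 where "C0 = \<rho> ` free_vars \<phi> \<inter> C"
  have "definable_pred C0 P"
  proof (rule definable_predI[OF 1(1)])
    show "(if i \<in> free_vars \<phi> then \<rho> i else (\<lambda>_. u0)) \<in> insert (\<lambda>_. u0) C0" for i
      using 1(2)[of i] by (auto simp: C0_def)
    show "P x = sat M (\<lambda>i. (if i \<in> free_vars \<phi> then \<rho> i else (\<lambda>_. u0)) x) \<phi>" for x
      unfolding 1(3) by (rule sat_cong) auto
  qed
  then show ?thesis by (intro exI[of _ C0]) (auto simp: C0_def finite_free_vars)
qed

text \<open>The coordinate functions in the scope of a quantifier over \<open>assignments\<close>.\<close>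

definition ext_coords :: "('a \<Rightarrow> 'u) set \<Rightarrow> ('a \<times> (nat \<Rightarrow> 'u) \<Rightarrow> 'u) set" where
  "ext_coords C = {\<lambda>p. f (fst p) | f. f \<in> C} \<union> range (\<lambda>i p. snd p i)"

lemma ext_coords_fst: "f \<in> C \<Longrightarrow> (\<lambda>p. f (fst p)) \<in> ext_coords C" by (auto simp: ext_coords_def)
lemma ext_coords_snd: "(\<lambda>p. snd p i) \<in> ext_coords C" by (auto simp: ext_coords_def)

text \<open>A block of \<open>n\<close> nested quantifiers rebinds the variables below
  \<open>n\<close>. For large \<open>n\<close> this amounts to a quantifier over a whole sequence,
  of which a formula reads finitely many entries.\<close>

lemma sat_ex_many:
  assumes "is_formula L \<phi>"
  shows "\<exists>\<phi>'. is_formula L \<phi>' \<and>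
    (\<forall>s. sat M s \<phi>' \<longleftrightarrow> (\<exists>v\<in>assignments. sat M (\<lambda>i. if i < n then v i else s i) \<phi>))"
proof (induction n)
  case 0
  have "(\<lambda>_. u0) \<in> assignments" by (simp add: assignments_def u0)
  then show ?case using assms by auto
next
  case (Suc n)
  then obtain \<phi>' where \<phi>': "is_formula L \<phi>'"
    "\<And>s. sat M s \<phi>' \<longleftrightarrow> (\<exists>v\<in>assignments. sat M (\<lambda>i. if i < n then v i else s i) \<phi>)" by blast
  have "sat M s (Ex n \<phi>') \<longleftrightarrow> (\<exists>v\<in>assignments. sat M (\<lambda>i. if i < Suc n then v i else s i) \<phi>)" for s
  proof
    assume "sat M s (Ex n \<phi>')"
    then obtain a v where av: "a \<in> univ M" "v \<in> assignments"
      "sat M (\<lambda>i. if i < n then v i else (s(n := a)) i) \<phi>" by (auto simp: \<phi>')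
    have "(\<lambda>i. if i < n then v i else (s(n := a)) i) = (\<lambda>i. if i < Suc n then (v(n := a)) i else s i)"
      by (auto simp: fun_eq_iff less_Suc_eq)
    then show "\<exists>v\<in>assignments. sat M (\<lambda>i. if i < Suc n then v i else s i) \<phi>"
      using av assignments_upd by metis
  next
    assume "\<exists>v\<in>assignments. sat M (\<lambda>i. if i < Suc n then v i else s i) \<phi>"
    then obtain v where v: "v \<in> assignments" "sat M (\<lambda>i. if i < Suc n then v i else s i) \<phi>" by blast
    have "(\<lambda>i. if i < n then v i else (s(n := v n)) i) = (\<lambda>i. if i < Suc n then v i else s i)"
      by (auto simp: fun_eq_iff less_Suc_eq)
    then have "sat M (\<lambda>i. if i < n then v i else (s(n := v n)) i) \<phi>" using v(2) by simp
    then show "sat M s (Ex n \<phi>')" using v(1) assignments_app[OF v(1)] unfolding sat.simps \<phi>'(2) by blast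
  qed
  then show ?case using \<phi>'(1) by (intro exI[of _ "Ex n \<phi>'"]) simp
qed

lemma definable_pred_ex:
  assumes "definable_pred (ext_coords C) (\<lambda>p. P (fst p) (snd p))"
  shows "definable_pred C (\<lambda>x. \<exists>v\<in>assignments. P x v)"
proof -
  from assms(1) obtain \<phi> \<rho> where 1: "is_formula L \<phi>" "\<And>i. \<rho> i \<in> insert (\<lambda>_. u0) (ext_coords C)"
    "\<And>p. P (fst p) (snd p) \<longleftrightarrow> sat M (\<lambda>i. \<rho> i p) \<phi>" by (rule definable_predE) (rule that; simp)
  \<comment> \<open>Every substituted function either reads an entry of the quantified sequence or
    depends on the outer environment only. The pair \<open>q\<close> records which:
    \<open>Some i\<close> for entry \<open>i\<close>, or \<open>None\<close> together with the
    function of the outer environment.\<close>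
  have "\<exists>q. (\<exists>i. \<rho> k = (\<lambda>p. snd p i) \<and> snd q = Some i) \<or>
      (fst q \<in> insert (\<lambda>_. u0) C \<and> \<rho> k = (\<lambda>p. fst q (fst p)) \<and> snd q = None)" for k
  proof -
    consider (const) "\<rho> k = (\<lambda>_. u0)" | (old) f where "f \<in> C" "\<rho> k = (\<lambda>p. f (fst p))"
      | (new) i where "\<rho> k = (\<lambda>p. snd p i)"
      using 1(2)[of k] unfolding ext_coords_def by blast
    then show ?thesis
    proof cases
      case const
      then show ?thesis by (intro exI[of _ "(\<lambda>_. u0, None)"]) simp
    next
      case (old f)
      then show ?thesis by (intro exI[of _ "(f, None)"]) simp
    next
      case (new i)
      then show ?thesis by (intro exI[of _ "(\<lambda>_. u0, Some i)"]) simp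
    qed
  qed
  then obtain q where q: "\<And>k. (\<exists>i. \<rho> k = (\<lambda>p. snd p i) \<and> snd (q k) = Some i) \<or>
      (fst (q k) \<in> insert (\<lambda>_. u0) C \<and> \<rho> k = (\<lambda>p. fst (q k) (fst p)) \<and> snd (q k) = None)"
    by metis
  define g j where "g k = fst (q k)" and "j k = snd (q k)" for k
  have gj: "(\<exists>i. \<rho> k = (\<lambda>p. snd p i) \<and> j k = Some i) \<or>
      (g k \<in> insert (\<lambda>_. u0) C \<and> \<rho> k = (\<lambda>p. g k (fst p)) \<and> j k = None)" for k
    using q[of k] by (simp only: g_def j_def)
  \<comment> \<open>\<open>n\<close> bounds the entries of the quantified sequence that occur. They
    become the variables below \<open>n\<close>, which get bound; any other variable
    \<open>k\<close> moves to \<open>n + k\<close>, out of their reach.\<close>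
  have "finite (the ` j ` free_vars \<phi>)" by (simp add: finite_free_vars)
  then obtain n where n: "\<And>k. k \<in> free_vars \<phi> \<Longrightarrow> the (j k) < n"
    using finite_nat_set_iff_bounded by fastforce
  obtain \<phi>' where \<phi>': "is_formula L \<phi>'" "\<And>s. sat M s \<phi>' \<longleftrightarrow>
      sat M (\<lambda>k. s (case j k of Some i \<Rightarrow> i | None \<Rightarrow> n + k)) \<phi>"
    using rename_formula[OF 1(1), where M = M and
        \<rho> = "\<lambda>k. case j k of Some i \<Rightarrow> i | None \<Rightarrow> n + k"] by blast
  obtain \<phi>'' where \<phi>'': "is_formula L \<phi>''"
    "\<And>s. sat M s \<phi>'' \<longleftrightarrow> (\<exists>v\<in>assignments. sat M (\<lambda>i. if i < n then v i else s i) \<phi>')"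
    using sat_ex_many[OF \<phi>'(1), of n] by blast
  define \<sigma> where "\<sigma> i = (if j (i - n) = None then g (i - n) else (\<lambda>_. u0))" for i
  show ?thesis
  proof (rule definable_predI[OF \<phi>''(1)])
    show "\<sigma> i \<in> insert (\<lambda>_. u0) C" for i
      using gj[of "i - n"] by (auto simp: \<sigma>_def)
    fix x
    have "sat M (\<lambda>k. (\<lambda>i. if i < n then v i else \<sigma> i x) (case j k of Some i \<Rightarrow> i | None \<Rightarrow> n + k)) \<phi>
        \<longleftrightarrow> sat M (\<lambda>i. \<rho> i (x, v)) \<phi>" for v
    proof (rule sat_cong)
      fix k assume "k \<in> free_vars \<phi>"
      with n have "the (j k) < n" by blast
      then show "(\<lambda>i. if i < n then v i else \<sigma> i x) (case j k of Some i \<Rightarrow> i | None \<Rightarrow> n + k)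
          = \<rho> k (x, v)"
        using gj[of k] by (auto simp: \<sigma>_def)
    qed
    then show "(\<exists>v\<in>assignments. P x v) \<longleftrightarrow> sat M (\<lambda>i. \<sigma> i x) \<phi>''"
      unfolding \<phi>'' \<phi>' using 1(3)[of "(x, v)" for v] by (simp add: comp_def)
  qed
qed

lemma definable_pred_all:
  assumes "definable_pred (ext_coords C) (\<lambda>p. P (fst p) (snd p))"
  shows "definable_pred C (\<lambda>x. \<forall>v\<in>assignments. P x v)"
proof -
  have "definable_pred C (\<lambda>x. \<not> (\<exists>v\<in>assignments. \<not> P x v))" by (intro definable_pred_not definable_pred_ex assms)
  then show ?thesis by (simp only: bex_simps(8) not_not)
qed

text \<open>Environments may have values outside \<open>univ M\<close>, so this is a genuine
  condition. It is expressible because \<open>Ex\<close> ranges over \<open>univ M\<close>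
  only.\<close>

lemma definable_pred_univ:
  assumes "f \<in> C"
  shows "definable_pred C (\<lambda>x. f x \<in> univ M)"
proof -
  have "definable_pred C (\<lambda>x. \<exists>v\<in>assignments. f x = v 0)"
    by (rule definable_pred_ex, rule definable_pred_eq[OF ext_coords_fst[OF assms] ext_coords_snd])
  moreover have "(\<exists>v\<in>assignments. f x = v 0) \<longleftrightarrow> f x \<in> univ M" for x
    by (auto simp: assignments_app intro!: bexI[of _ "\<lambda>_. f x"] assignmentsI)
  ultimately show ?thesis by simp
qed

definition constants :: "('a \<Rightarrow> 'u) set" where "constants = {\<lambda>_. c | c. c \<in> univ M}"
text \<open>Predicates over \<open>coords n\<close> stand for subsets of \<open>M\<^sup>n\<close>
  definable with parameters, those over \<open>coords2 n k\<close> for definable relations between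
  \<open>M\<^sup>n\<close> and \<open>M\<^sup>k\<close>. They take infinite sequences but ignore all
  further entries.\<close>

definition coords :: "nat \<Rightarrow> ((nat \<Rightarrow> 'u) \<Rightarrow> 'u) set" where
  "coords n = {\<lambda>x. x i | i. i < n} \<union> constants"
definition coords2 :: "nat \<Rightarrow> nat \<Rightarrow> ((nat \<Rightarrow> 'u) \<times> (nat \<Rightarrow> 'u) \<Rightarrow> 'u) set" where
  "coords2 n k = {\<lambda>p. fst p i | i. i < n} \<union> {\<lambda>p. snd p i | i. i < k} \<union> constants"

lemma coordsI: "i < n \<Longrightarrow> (\<lambda>x. x i) \<in> coords n" "c \<in> univ M \<Longrightarrow> (\<lambda>_. c) \<in> coords n"
  by (auto simp: coords_def constants_def)
lemma coords2I: "i < n \<Longrightarrow> (\<lambda>p. fst p i) \<in> coords2 n k" "i < k \<Longrightarrow> (\<lambda>p. snd p i) \<in> coords2 n k"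
    "c \<in> univ M \<Longrightarrow> (\<lambda>_. c) \<in> coords2 n k"
  by (auto simp: coords2_def constants_def)

lemma definable_pred_coords_subst:
  assumes "definable_pred (coords n) P" "\<And>i. i < n \<Longrightarrow> (\<lambda>x. g x i) \<in> C" "constants \<subseteq> C"
  shows "definable_pred C (\<lambda>x. P (g x))"
  using assms by (intro definable_pred_subst[OF assms(1)]) (auto simp: coords_def constants_def)

lemma definable_pred_coords2_subst:
  assumes "definable_pred (coords2 n k) (\<lambda>p. P (fst p) (snd p))" "\<And>i. i < n \<Longrightarrow> (\<lambda>x. g x i) \<in> C"
    "\<And>i. i < k \<Longrightarrow> (\<lambda>x. h x i) \<in> C" "constants \<subseteq> C"
  shows "definable_pred C (\<lambda>x. P (g x) (h x))"
proof -
  have "(\<lambda>x. f (g x, h x)) \<in> C" if "f \<in> coords2 n k" for f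
    using that assms(2-) by (auto simp: coords2_def constants_def)
  with definable_pred_subst[OF assms(1), of "\<lambda>x. (g x, h x)" C] show ?thesis by simp
qed

lemma definable_pred_coords_cong:
  assumes "definable_pred (coords n) P" "\<And>i. i < n \<Longrightarrow> x i = y i"
  shows "P x \<longleftrightarrow> P y"
proof -
  from assms(1) obtain \<phi> \<rho> where 1: "is_formula L \<phi>" "\<And>i. \<rho> i \<in> insert (\<lambda>_. u0) (coords n)"
    "\<And>p. P p \<longleftrightarrow> sat M (\<lambda>i. \<rho> i p) \<phi>" by (rule definable_predE) (rule that; simp)
  have "\<rho> i x = \<rho> i y" for i using 1(2)[of i] assms(2) by (auto simp: coords_def constants_def)
  then show ?thesis by (simp add: 1)
qed

lemma definable_pred_coords2_cong:
  assumes "definable_pred (coords2 n k) (\<lambda>p. P (fst p) (snd p))" "\<And>i. i < n \<Longrightarrow> x i = x' i" "\<And>i. i < k \<Longrightarrow> y i = y' i"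
  shows "P x y \<longleftrightarrow> P x' y'"
proof -
  from assms(1) obtain \<phi> \<rho> where 1: "is_formula L \<phi>" "\<And>i. \<rho> i \<in> insert (\<lambda>_. u0) (coords2 n k)"
    "\<And>p. P (fst p) (snd p) \<longleftrightarrow> sat M (\<lambda>i. \<rho> i p) \<phi>" by (rule definable_predE) (rule that; simp)
  have "\<rho> i (x, y) = \<rho> i (x', y')" for i using 1(2)[of i] assms(2,3) by (auto simp: coords2_def constants_def)
  then show ?thesis using 1(3)[of "(x,y)"] 1(3)[of "(x',y')"] by simp
qed

lemma definable_iff_definable_pred:
  assumes "X \<subseteq> tuples (univ M) n"
  shows "definable L M n X \<longleftrightarrow> definable_pred (coords n) (\<lambda>x. restrict x {..<n} \<in> X)"
proof
  assume "definable L M n X"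
  then obtain \<phi> e where \<phi>: "is_formula L \<phi>" "range e \<subseteq> univ M"
    "X = {x \<in> tuples (univ M) n. sat M (prepend n x e) \<phi>}" unfolding definable_def by blast
  have "(\<lambda>x. prepend n x e i) \<in> coords n" for i
    using \<phi>(2) by (cases "i < n") (auto simp: prepend_def coordsI image_subset_iff)
  then have "definable_pred (coords n) (\<lambda>x. (\<forall>i<n. x i \<in> univ M) \<and> sat M (prepend n x e) \<phi>)"
    by (intro definable_pred_conj definable_pred_all_less definable_pred_univ definable_pred_sat \<phi>(1)) (simp_all add: coordsI)
  moreover have "prepend n (restrict x {..<n}) e = prepend n x e" for x
    by (auto simp: prepend_def)
  ultimately show "definable_pred (coords n) (\<lambda>x. restrict x {..<n} \<in> X)"
    by (simp add: \<phi>(3) PiE_def Pi_def)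
next
  assume "definable_pred (coords n) (\<lambda>x. restrict x {..<n} \<in> X)"
  then obtain \<phi> \<rho> where 1: "is_formula L \<phi>" "\<And>i. \<rho> i \<in> insert (\<lambda>_. u0) (coords n)"
    "\<And>x. restrict x {..<n} \<in> X \<longleftrightarrow> sat M (\<lambda>i. \<rho> i x) \<phi>" by (rule definable_predE) (rule that; simp)
  \<comment> \<open>Each substituted function is one of the \<open>n\<close> coordinates or a
    constant. A constant used for variable \<open>k\<close> becomes the parameter
    \<open>c k\<close>, which \<open>prepend n x c\<close> puts at position
    \<open>n + k\<close>.\<close>
  have "\<exists>q. (\<exists>i<n. \<rho> k = (\<lambda>x. x i) \<and> fst q = Some i \<and> snd q \<in> univ M) \<or>
      (snd q \<in> univ M \<and> \<rho> k = (\<lambda>_. snd q) \<and> fst q = None)" for k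
  proof -
    consider (const) c where "c \<in> univ M" "\<rho> k = (\<lambda>_. c)" | (var) i where "i < n" "\<rho> k = (\<lambda>x. x i)"
      using 1(2)[of k] u0 unfolding coords_def constants_def by blast
    then show ?thesis
    proof cases
      case (const c)
      then show ?thesis by (intro exI[of _ "(None, c)"]) simp
    next
      case (var i)
      then show ?thesis using u0 by (intro exI[of _ "(Some i, u0)"]) auto
    qed
  qed
  then obtain q where q: "\<And>k. (\<exists>i<n. \<rho> k = (\<lambda>x. x i) \<and> fst (q k) = Some i \<and> snd (q k) \<in> univ M) \<or>
      (snd (q k) \<in> univ M \<and> \<rho> k = (\<lambda>_. snd (q k)) \<and> fst (q k) = None)"
    by metis
  define c j where "c k = snd (q k)" and "j k = fst (q k)" for k
  have jc: "(\<exists>i<n. \<rho> k = (\<lambda>x. x i) \<and> j k = Some i \<and> c k \<in> univ M) \<or>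
      (c k \<in> univ M \<and> \<rho> k = (\<lambda>_. c k) \<and> j k = None)" for k
    using q[of k] by (simp only: c_def j_def)
  obtain \<phi>' where \<phi>': "is_formula L \<phi>'" "\<And>s. sat M s \<phi>' \<longleftrightarrow>
      sat M (\<lambda>k. s (case j k of Some i \<Rightarrow> i | None \<Rightarrow> n + k)) \<phi>"
    using rename_formula[OF 1(1), where M = M and
        \<rho> = "\<lambda>k. case j k of Some i \<Rightarrow> i | None \<Rightarrow> n + k"] by blast
  have "(\<lambda>k. prepend n x c (case j k of Some i \<Rightarrow> i | None \<Rightarrow> n + k)) = (\<lambda>k. \<rho> k x)" for x
  proof
    fix k show "prepend n x c (case j k of Some i \<Rightarrow> i | None \<Rightarrow> n + k) = \<rho> k x"
      using jc[of k] by (auto simp: prepend_def)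
  qed
  then have "sat M (prepend n x c) \<phi>' \<longleftrightarrow> restrict x {..<n} \<in> X" for x by (simp add: \<phi>' 1(3))
  moreover have "restrict x {..<n} = x" if "x \<in> tuples (univ M) n" for x
    using that by (rule PiE_restrict)
  ultimately have "X = {x \<in> tuples (univ M) n. sat M (prepend n x c) \<phi>'}"
    using assms by auto
  moreover have "range c \<subseteq> univ M" using jc by blast
  ultimately show "definable L M n X" unfolding definable_def using \<phi>'(1) by blast
qed

lemma definableI:
  assumes "definable_pred (coords n) P"
  shows "definable L M n {x \<in> tuples (univ M) n. P x}"
proof (subst definable_iff_definable_pred)
  have "P (restrict x {..<n}) = P x" for x by (rule definable_pred_coords_cong[OF assms]) auto
  then have "restrict x {..<n} \<in> {x \<in> tuples (univ M) n. P x} \<longleftrightarrow> (\<forall>i<n. x i \<in> univ M) \<and> P x" for x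
    by (auto simp: PiE_def Pi_def)
  moreover have "definable_pred (coords n) (\<lambda>x. (\<forall>i<n. x i \<in> univ M) \<and> P x)"
    by (intro definable_pred_conj definable_pred_all_less definable_pred_univ assms) (auto simp: coordsI)
  ultimately show "definable_pred (coords n) (\<lambda>x. restrict x {..<n} \<in> {x \<in> tuples (univ M) n. P x})" by simp
qed auto

lemma consts_ext_coords: "constants \<subseteq> C \<Longrightarrow> constants \<subseteq> ext_coords C"
  by (auto simp: constants_def ext_coords_def)

lemma consts_coords: "constants \<subseteq> coords n" "constants \<subseteq> coords2 n k"
  by (auto simp: coords_def coords2_def)

section \<open>Saturation and uniform finiteness\<close>

definition all_coords :: "((nat \<Rightarrow> 'u) \<Rightarrow> 'u) set" where
  "all_coords = range (\<lambda>i x. x i) \<union> constants"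

lemma all_coordsI: "(\<lambda>x. x i) \<in> all_coords" "c \<in> univ M \<Longrightarrow> (\<lambda>_. c) \<in> all_coords"
  by (auto simp: all_coords_def constants_def)

lemma consts_all_coords: "constants \<subseteq> all_coords" by (auto simp: all_coords_def)

text \<open>The finite counterpart of \<open>all_coords\<close>: what a type in \<open>r\<close>
  variables over the parameters \<open>F\<close> may mention.\<close>

definition fin_coords :: "nat \<Rightarrow> 'u set \<Rightarrow> ((nat \<Rightarrow> 'u) \<Rightarrow> 'u) set" where
  "fin_coords r F = {\<lambda>x. x i | i. i < r} \<union> {\<lambda>_. c | c. c \<in> F}"

lemma ext_coords_mono: "C \<subseteq> C' \<Longrightarrow> ext_coords C \<subseteq> ext_coords C'" by (auto simp: ext_coords_def)

lemma fin_coords_mono: "r \<le> r' \<Longrightarrow> F \<subseteq> F' \<Longrightarrow> fin_coords r F \<subseteq> fin_coords r' F'"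
  unfolding fin_coords_def by fastforce

lemma finite_subset_ext_coords_all_coords:
  "finite C \<Longrightarrow> C \<subseteq> ext_coords all_coords \<Longrightarrow> \<exists>r F. finite F \<and> F \<subseteq> univ M \<and> C \<subseteq> ext_coords (fin_coords r F)"
proof (induction C rule: finite_induct)
  case (insert f C)
  then obtain r F where rF: "finite F" "F \<subseteq> univ M" "C \<subseteq> ext_coords (fin_coords r F)" by blast
  consider (old) i where "f = (\<lambda>p. fst p i)" | (const) c where "c \<in> univ M" "f = (\<lambda>_. c)"
    | (new) i where "f = (\<lambda>p. snd p i)"
    using insert.prems unfolding ext_coords_def all_coords_def constants_def by blast
  then have "\<exists>r' F'. finite F' \<and> F' \<subseteq> univ M \<and> r \<le> r' \<and> F \<subseteq> F' \<and> f \<in> ext_coords (fin_coords r' F')"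
  proof cases
    case (old i)
    have "(\<lambda>x. x i) \<in> fin_coords (max r (Suc i)) F" by (auto simp: fin_coords_def)
    from ext_coords_fst[OF this] show ?thesis using rF old by (intro exI[of _ "max r (Suc i)"] exI[of _ F]) simp
  next
    case (const c)
    have "(\<lambda>_. c) \<in> fin_coords r (insert c F)" by (auto simp: fin_coords_def)
    from ext_coords_fst[OF this] show ?thesis using rF const
      by (intro exI[of _ r] exI[of _ "insert c F"]) auto
  next
    case (new i)
    then show ?thesis using rF ext_coords_snd[of i] by (intro exI[of _ r] exI[of _ F]) simp
  qed
  then obtain r' F' where r'F': "finite F'" "F' \<subseteq> univ M" "r \<le> r'" "F \<subseteq> F'" "f \<in> ext_coords (fin_coords r' F')"
    by blast
  have "C \<subseteq> ext_coords (fin_coords r' F')"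
    using rF(3) ext_coords_mono[OF fin_coords_mono[OF r'F'(3,4)]] by blast
  then show ?case using r'F' by (intro exI[of _ r'] exI[of _ F']) simp
qed (use u0 in \<open>auto intro!: exI[of _ "{}"]\<close>)

text \<open>\<open>from_nat_into (insert u0 F)\<close> lists the parameters in a sequence of finite
  range, as \<open>omega_saturated\<close> demands. It depends on \<open>F\<close> only and thus
  serves infinitely many predicates \<open>Q\<close> at once.\<close>

lemma fin_coords_formula:
  assumes "finite F" "definable_pred (fin_coords r F) Q"
  shows "\<exists>\<theta>. is_formula L \<theta> \<and>
    (\<forall>x. sat M (prepend r x (from_nat_into (insert u0 F))) \<theta> \<longleftrightarrow> Q x)"
proof -
  from assms(2) obtain \<phi> \<rho> where 1: "is_formula L \<phi>" "\<And>i. \<rho> i \<in> insert (\<lambda>_. u0) (fin_coords r F)"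
    "\<And>x. Q x \<longleftrightarrow> sat M (\<lambda>i. \<rho> i x) \<phi>" by (rule definable_predE) (rule that; simp)
  define e where "e = from_nat_into (insert u0 F)"
  have e: "\<exists>i. e i = c" if "c \<in> insert u0 F" for c
  proof -
    have "countable (insert u0 F)" using assms(1) by (intro countable_finite) simp
    from from_nat_into_to_nat_on[OF this that] show ?thesis unfolding e_def by blast
  qed
  have "\<exists>j. \<forall>x. prepend r x e j = \<rho> k x" for k
  proof -
    consider (const) c where "c \<in> insert u0 F" "\<rho> k = (\<lambda>_. c)" | (var) i where "i < r" "\<rho> k = (\<lambda>x. x i)"
      using 1(2)[of k] unfolding fin_coords_def by blast
    then show ?thesis
    proof cases
      case (const c)
      with e obtain i where "e i = c" by blast
      then show ?thesis using const by (intro exI[of _ "r + i"]) (simp add: prepend_def)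
    next
      case (var i)
      then show ?thesis by (intro exI[of _ i]) (simp add: prepend_def)
    qed
  qed
  then obtain j where j: "\<And>k x. prepend r x e (j k) = \<rho> k x" by metis
  obtain \<theta> where "is_formula L \<theta>" "\<forall>s. sat M s \<theta> \<longleftrightarrow> sat M (\<lambda>i. s (j i)) \<phi>"
    using rename_formula[OF 1(1), where M = M and \<rho> = j] by blast
  then show ?thesis unfolding e_def[symmetric] by (intro exI[of _ \<theta>]) (simp add: j 1(3))
qed

text \<open>Without a bound, the formulas saying that the fibre over \<open>c\<close> has at least
  \<open>N\<close> elements would be finitely satisfiable; by saturation one fibre would satisfy
  them all and be infinite.\<close>

lemma uniform_finiteness:
  assumes sat: "omega_saturated L M"
    and P: "definable_pred (ext_coords all_coords) (\<lambda>p. P (fst p) (snd p 0))"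
    and fin: "\<And>c. c \<in> assignments \<Longrightarrow> finite {t \<in> univ M. P c t}"
  shows "\<exists>N. \<forall>c\<in>assignments. card {t \<in> univ M. P c t} \<le> N"
proof (rule ccontr)
  assume unbdd: "\<nexists>N. \<forall>c\<in>assignments. card {t \<in> univ M. P c t} \<le> N"
  \<comment> \<open>\<open>P\<close> reads finitely many entries of \<open>c\<close> and finitely
    many constants, which gives a type in \<open>r\<close> variables over a finite set
    \<open>F\<close>.\<close>
  obtain C0 where C0: "finite C0" "C0 \<subseteq> ext_coords all_coords" "definable_pred C0 (\<lambda>p. P (fst p) (snd p 0))"
    using definable_pred_finite_coords[OF P] by blast
  obtain r F where rF: "finite F" "F \<subseteq> univ M" "C0 \<subseteq> ext_coords (fin_coords r F)"
    using finite_subset_ext_coords_all_coords[OF C0(1,2)] by blast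
  have P': "definable_pred (ext_coords (fin_coords r F)) (\<lambda>p. P (fst p) (snd p 0))"
    by (rule definable_pred_mono[OF C0(3) rF(3)])
  \<comment> \<open>\<open>T\<close> lists \<open>N\<close> distinct elements of the fibre, so
    \<open>Q N c\<close> is a first-order form of the lower bound \<open>N\<close> on its
    size.\<close>
  define Q where "Q N c \<longleftrightarrow> (\<exists>T\<in>assignments. (\<forall>a<N. P c (T a)) \<and> (\<forall>a<N. \<forall>b<N. a \<noteq> b \<longrightarrow> T a \<noteq> T b))"
    for N :: nat and c
  have "definable_pred (ext_coords (fin_coords r F)) (\<lambda>p. P (fst p) (snd p a))" for a
  proof -
    have "(\<lambda>p. f (fst p, \<lambda>_. snd p a)) \<in> ext_coords (fin_coords r F)" if "f \<in> ext_coords (fin_coords r F)" for f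
      using that unfolding ext_coords_def by auto
    with definable_pred_subst[OF P', of "\<lambda>p. (fst p, \<lambda>_. snd p a)" "ext_coords (fin_coords r F)"] show ?thesis by simp
  qed
  then have "definable_pred (fin_coords r F) (Q N)" for N
    unfolding Q_def by (intro definable_pred_ex definable_pred_conj definable_pred_all_less definable_pred_imp definable_pred_const definable_pred_not definable_pred_eq ext_coords_snd)
  then have "\<exists>\<theta>. is_formula L \<theta> \<and>
      (\<forall>x. sat M (prepend r x (from_nat_into (insert u0 F))) \<theta> \<longleftrightarrow> Q N x)" for N
    by (rule fin_coords_formula[OF rF(1)])
  then obtain \<theta> where \<theta>: "\<And>N. is_formula L (\<theta> N)"
    "\<And>N x. sat M (prepend r x (from_nat_into (insert u0 F))) (\<theta> N) \<longleftrightarrow> Q N x" by metis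
  define e where "e = from_nat_into (insert u0 F)"
  have e: "range e = insert u0 F" unfolding e_def
    using rF(1) by (intro range_from_nat_into) (auto intro: countable_finite)
  \<comment> \<open>The conditions \<open>Q N\<close> get stronger with \<open>N\<close>, so a
    finite part of the type follows from a single one of them.\<close>
  have Q_mono: "Q N c" if q: "Q N' c" "N \<le> N'" for N N' c
  proof -
    obtain T where T: "T \<in> assignments" "\<forall>a<N'. P c (T a)" "\<forall>a<N'. \<forall>b<N'. a \<noteq> b \<longrightarrow> T a \<noteq> T b"
      using q(1) unfolding Q_def by blast
    show ?thesis unfolding Q_def using T q(2) by (intro bexI[OF _ T(1)]) auto
  qed
  have Q_le: "N \<le> card {t \<in> univ M. P c t}" if q: "Q N c" "c \<in> assignments" for N c
  proof -
    obtain T where T: "T \<in> assignments" "\<forall>a<N. P c (T a)" "\<forall>a<N. \<forall>b<N. a \<noteq> b \<longrightarrow> T a \<noteq> T b"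
      using q(1) unfolding Q_def by blast
    have "inj_on T {..<N}" using T(3) by (auto simp: inj_on_def)
    then have "card (T ` {..<N}) = N" by (simp add: card_image)
    moreover have "T ` {..<N} \<subseteq> {t \<in> univ M. P c t}" using T(1,2) assignments_app by auto
    ultimately show ?thesis using card_mono[OF fin[OF q(2)]] by metis
  qed
  have Q_ge: "\<exists>c\<in>assignments. Q N c" for N
  proof -
    obtain c where c: "c \<in> assignments" "card {t \<in> univ M. P c t} > N" using unbdd by (meson not_le)
    obtain g where g: "bij_betw g {0..<card {t \<in> univ M. P c t}} {t \<in> univ M. P c t}"
      using ex_bij_betw_nat_finite[OF fin[OF c(1)]] by blast
    define T where "T i = (if i < N then g i else u0)" for i
    have "g i \<in> {t \<in> univ M. P c t}" if "i < N" for i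
      by (rule bij_betw_apply[OF g]) (use that c(2) in simp)
    then have gT: "g i \<in> univ M" "P c (g i)" if "i < N" for i
      using that by blast+
    have "T \<in> assignments" by (rule assignmentsI) (simp add: T_def gT(1) u0)
    moreover have "\<forall>a<N. \<forall>b<N. a \<noteq> b \<longrightarrow> T a \<noteq> T b"
    proof (intro allI impI)
      fix a b assume ab: "a < N" "b < N" "a \<noteq> b"
      then have "g a \<noteq> g b"
        using inj_onD[OF bij_betw_imp_inj_on[OF g], of a b] c(2) by auto
      then show "T a \<noteq> T b" using ab by (simp add: T_def)
    qed
    moreover have "\<forall>a<N. P c (T a)" by (simp add: T_def gT(2))
    ultimately show ?thesis using c(1) unfolding Q_def by blast
  qed
  have "\<exists>x\<in>tuples (univ M) r. \<forall>\<phi>\<in>range \<theta>. sat M (prepend r x e) \<phi>"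
  proof (rule mp[OF sat[unfolded omega_saturated_def, THEN spec[of _ r], THEN spec[of _ e],
        THEN spec[of _ "range \<theta>"]]], intro conjI)
    show "range e \<subseteq> univ M" "finite (range e)" using e rF u0 by auto
    show "\<forall>\<phi>\<in>range \<theta>. is_formula L \<phi>" using \<theta>(1) by blast
    show "\<forall>q\<subseteq>range \<theta>. finite q \<longrightarrow> (\<exists>x\<in>tuples (univ M) r. \<forall>\<phi>\<in>q. sat M (prepend r x e) \<phi>)"
    proof (intro allI impI)
      fix q assume "q \<subseteq> range \<theta>" "finite q"
      then obtain I where I: "finite I" "q = \<theta> ` I"
        using finite_subset_image[of q \<theta> UNIV] by blast
      then obtain N where N: "\<And>i. i \<in> I \<Longrightarrow> i \<le> N" using finite_nat_set_iff_bounded_le[of I] by blast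
      obtain c where c: "c \<in> assignments" "Q N c" using Q_ge by blast
      have "sat M (prepend r (restrict c {..<r}) e) (\<theta> i)" if "i \<in> I" for i
      proof -
        have "prepend r (restrict c {..<r}) e = prepend r c e" by (auto simp: prepend_def)
        then show ?thesis using Q_mono[OF c(2) N[OF that]] by (simp add: \<theta>(2) e_def)
      qed
      moreover have "restrict c {..<r} \<in> tuples (univ M) r" using assignments_app[OF c(1)] by simp
      ultimately show "\<exists>x\<in>tuples (univ M) r. \<forall>\<phi>\<in>q. sat M (prepend r x e) \<phi>"
        using I(2) by blast
    qed
  qed
  then obtain x where x: "x \<in> tuples (univ M) r" "\<And>N. sat M (prepend r x e) (\<theta> N)" by (meson rangeI)
  \<comment> \<open>The type does not mention entries from \<open>r\<close> on; they are set to
    \<open>u0\<close> to obtain an assignment.\<close>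
  define c where "c i = (if i < r then x i else u0)" for i
  have c: "c \<in> assignments" by (rule assignmentsI) (use x(1) u0 in \<open>auto simp: c_def\<close>)
  have "prepend r x e = prepend r c e" by (auto simp: prepend_def c_def)
  then have "Q N c" for N using x(2)[of N] by (simp add: \<theta>(2) e_def)
  from Q_le[OF this c] show False using not_less_eq_eq by blast
qed

section \<open>Tuples, assignments and graphs\<close>

definition merge_at :: "nat \<Rightarrow> (nat \<Rightarrow> 'u) \<Rightarrow> (nat \<Rightarrow> 'u) \<Rightarrow> nat \<Rightarrow> 'u" where
  "merge_at m u y = (\<lambda>i. if i < m then u i else y i)"

text \<open>An extensional tuple is \<open>undefined\<close> beyond its length, which may lie
  outside \<open>univ M\<close>; padding by \<open>u0\<close> yields an assignment.\<close>

definition pad :: "nat \<Rightarrow> (nat \<Rightarrow> 'u) \<Rightarrow> nat \<Rightarrow> 'u" where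
  "pad n x = (\<lambda>i. if i < n then x i else u0)"

lemma pad_S: "(\<And>i. i < n \<Longrightarrow> x i \<in> univ M) \<Longrightarrow> pad n x \<in> assignments"
  by (intro assignmentsI) (simp add: pad_def u0)

lemma pad_less: "i < n \<Longrightarrow> pad n x i = x i"
  by (simp add: pad_def)

lemma pad_tuples: "x \<in> tuples (univ M) n \<Longrightarrow> pad n x \<in> assignments"
  by (rule pad_S) (simp add: PiE_iff)

lemma restrict_pad: "restrict (pad n x) {..<n} = restrict x {..<n}"
  by (rule restrict_ext) (simp add: pad_def)

lemma restrict_tuples: "restrict x {..<n} \<in> tuples (univ M) n \<longleftrightarrow> (\<forall>i<n. x i \<in> univ M)"
  by (auto simp: PiE_iff)

lemma restrict_S: "x \<in> assignments \<Longrightarrow> restrict x {..<n} \<in> tuples (univ M) n"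
  unfolding restrict_tuples by (simp add: assignments_app)

lemma restrict_eq_iff: "restrict x {..<n::nat} = restrict y {..<n} \<longleftrightarrow> (\<forall>i<n. x i = y i)"
  by (metis lessThan_iff restrict_apply' restrict_ext)

lemma graph_on_iff:
  assumes X: "X \<subseteq> tuples (univ M) m" and f: "f \<in> X \<rightarrow> tuples (univ M) n"
  shows "restrict (prepend m a z) {..<m + n} \<in> graph_on m n X f \<longleftrightarrow>
    restrict a {..<m} \<in> X \<and> f (restrict a {..<m}) = restrict z {..<n}" (is "?l \<longleftrightarrow> ?r")
proof
  assume ?l
  then obtain x where x: "x \<in> X" "restrict (prepend m a z) {..<m + n} = restrict (prepend m x (f x)) {..<m + n}"
    unfolding graph_on_def by (rule imageE)
  have eq: "prepend m a z i = prepend m x (f x) i" if "i < m + n" for i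
    using x(2) that unfolding restrict_eq_iff by blast
  have xe: "x \<in> tuples (univ M) m" "f x \<in> tuples (univ M) n" using x(1) X f by auto
  have "restrict a {..<m} = restrict x {..<m}"
    unfolding restrict_eq_iff
  proof (intro allI impI)
    fix i assume "i < m"
    then show "a i = x i" using eq[of i] by (simp add: prepend_def)
  qed
  moreover have "restrict x {..<m} = x" using xe(1) by (rule PiE_restrict)
  moreover have "restrict z {..<n} = restrict (f x) {..<n}"
    unfolding restrict_eq_iff
  proof (intro allI impI)
    fix i assume "i < n"
    then show "z i = f x i" using eq[of "m + i"] by (simp add: prepend_def)
  qed
  moreover have "restrict (f x) {..<n} = f x" using xe(2) by (rule PiE_restrict)
  ultimately show ?r using x(1) by simp
next
  assume r: ?r
  have "restrict (prepend m a z) {..<m + n} =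
      restrict (prepend m (restrict a {..<m}) (f (restrict a {..<m}))) {..<m + n}"
    unfolding restrict_eq_iff
  proof (intro allI impI)
    fix i assume i: "i < m + n"
    then have "i - m < n" if "\<not> i < m" using that by linarith
    then show "prepend m a z i = prepend m (restrict a {..<m}) (f (restrict a {..<m})) i"
      using r by (cases "i < m") (simp_all add: prepend_def)
  qed
  then show ?l unfolding graph_on_def using r by blast
qed

text \<open>Splitting the tuples of the graph at position \<open>m\<close> gives a relation between
  two sequences, the form in which maps are handled below.\<close>

lemma definable_graph_iff:
  assumes X: "X \<subseteq> tuples (univ M) m" and f: "f \<in> X \<rightarrow> tuples (univ M) n"
  shows "definable L M (m + n) (graph_on m n X f) \<longleftrightarrow>
    definable_pred (coords2 m n) (\<lambda>p. restrict (fst p) {..<m} \<in> X \<and>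
      f (restrict (fst p) {..<m}) = restrict (snd p) {..<n})"
proof -
  have "graph_on m n X f \<subseteq> tuples (univ M) (m + n)"
  proof
    fix y assume "y \<in> graph_on m n X f"
    then obtain x where x: "x \<in> X" "y = restrict (prepend m x (f x)) {..<m + n}"
      unfolding graph_on_def by (rule imageE)
    then have "x \<in> tuples (univ M) m" "f x \<in> tuples (univ M) n" using X f by auto
    then show "y \<in> tuples (univ M) (m + n)"
      unfolding x(2) restrict_tuples by (simp add: prepend_def PiE_iff)
  qed
  note d = definable_iff_definable_pred[OF this]
  show ?thesis
  proof
    assume "definable L M (m + n) (graph_on m n X f)"
    then have D: "definable_pred (coords (m + n)) (\<lambda>x. restrict x {..<m + n} \<in> graph_on m n X f)"
      unfolding d .
    have "(\<lambda>p. prepend m (fst p) (snd p) i) \<in> coords2 m n" if "i < m + n" for i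
      using that by (cases "i < m") (simp_all add: prepend_def coords2I)
    then have "definable_pred (coords2 m n) (\<lambda>p. restrict (prepend m (fst p) (snd p)) {..<m + n} \<in> graph_on m n X f)"
      by (rule definable_pred_coords_subst[OF D]) (rule consts_coords | assumption)+
    then show "definable_pred (coords2 m n) (\<lambda>p. restrict (fst p) {..<m} \<in> X \<and>
      f (restrict (fst p) {..<m}) = restrict (snd p) {..<n})"
      unfolding graph_on_iff[OF X f] .
  next
    assume D: "definable_pred (coords2 m n) (\<lambda>p. restrict (fst p) {..<m} \<in> X \<and>
      f (restrict (fst p) {..<m}) = restrict (snd p) {..<n})"
    have "definable_pred (coords (m + n)) (\<lambda>x. restrict x {..<m} \<in> X \<and>
      f (restrict x {..<m}) = restrict (\<lambda>i. x (m + i)) {..<n})"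
      by (rule definable_pred_coords2_subst[OF D]) (simp_all add: coordsI consts_coords)
    moreover have "prepend m x (\<lambda>i. x (m + i)) = x" for x :: "nat \<Rightarrow> 'u"
      by (simp add: prepend_def fun_eq_iff)
    ultimately show "definable L M (m + n) (graph_on m n X f)"
      unfolding d by (simp only: graph_on_iff[OF X f, of x "\<lambda>i. x (m + i)" for x, symmetric])
  qed
qed

end

section \<open>Interiors of definable sets\<close>

locale visceral_structure = nonempty_structure L M
  for L :: "('f, 'r) language" and M :: "('f, 'r, 'u) fo_struct" +
  fixes \<phi> \<psi> :: "('f, 'r) formula"
  assumes saturated: "omega_saturated L M" and visceral: "visceral L M \<phi> \<psi>"
begin

section \<open>Entourages and balls\<close>

definition close :: "(nat \<Rightarrow> 'u) \<Rightarrow> 'u \<Rightarrow> 'u \<Rightarrow> bool" where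
  "close b x y \<longleftrightarrow> sat M (case_nat x (case_nat y b)) \<phi>"

text \<open>Parameter sequences index the entourages, so that a quantifier over entourages is one
  over \<open>assignments\<close> and hence first-order.\<close>

definition indices :: "(nat \<Rightarrow> 'u) set" where "indices = {b \<in> assignments. sat M b \<psi>}"

definition entourage :: "(nat \<Rightarrow> 'u) \<Rightarrow> ('u \<times> 'u) set" where
  "entourage b = {(x, y) \<in> univ M \<times> univ M. close b x y}"

lemma formulas: "is_formula L \<phi>" "is_formula L \<psi>"
  using visceral by (auto simp: visceral_def definable_uniform_structure_def)

lemma base: "uniform_base (univ M) (def_family M \<phi> \<psi>)"
  using visceral by (auto simp: visceral_def definable_uniform_structure_def)

lemma def_family_eq: "def_family M \<phi> \<psi> = entourage ` indices"
  unfolding def_family_def entourage_def close_def indices_def assignments_def by blast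

lemma indices_S: "b \<in> indices \<Longrightarrow> b \<in> assignments" by (simp add: indices_def)

lemma indices_nonempty: "\<exists>b. b \<in> indices"
  using base by (auto simp: uniform_base_def def_family_eq)

lemma indices_Int:
  assumes "b \<in> indices" "b' \<in> indices"
  shows "\<exists>c\<in>indices. \<forall>x\<in>univ M. \<forall>y\<in>univ M. close c x y \<longrightarrow> close b x y \<and> close b' x y"
proof -
  have "\<exists>E\<in>entourage ` indices. E \<subseteq> entourage b \<inter> entourage b'"
    using base assms by (simp add: uniform_base_def def_family_eq)
  then obtain c where "c \<in> indices" "entourage c \<subseteq> entourage b \<inter> entourage b'" by blast
  then show ?thesis unfolding entourage_def by blast
qed

lemma close_refl:
  assumes "b \<in> indices" "x \<in> univ M"
  shows "close b x x"
proof -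
  have "Id_on (univ M) \<subseteq> entourage b"
    using base assms by (simp add: uniform_base_def def_family_eq)
  then show ?thesis using assms(2) unfolding entourage_def by blast
qed

lemma close_comp:
  assumes "b \<in> indices"
  shows "\<exists>c\<in>indices. \<forall>x\<in>univ M. \<forall>y\<in>univ M. \<forall>z\<in>univ M. close c x y \<longrightarrow> close c y z \<longrightarrow> close b x z"
proof -
  have "\<exists>E\<in>entourage ` indices. E O E \<subseteq> entourage b"
    using base assms by (simp add: uniform_base_def def_family_eq)
  then obtain c where "c \<in> indices" "entourage c O entourage c \<subseteq> entourage b" by blast
  then show ?thesis unfolding entourage_def by blast
qed

lemma entourage_Image: "x \<in> univ M \<Longrightarrow> entourage b `` {x} = {y \<in> univ M. close b x y}"
  unfolding entourage_def by auto

text \<open>Every ball properly contains another one about the same centre, and this cannot be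
  iterated forever from a finite ball.\<close>

lemma infinite_ball:
  assumes "b \<in> indices" "x \<in> univ M"
  shows "infinite {y \<in> univ M. close b x y}"
proof
  assume "finite {y \<in> univ M. close b x y}"
  with assms(1) show False
  proof (induction "card {y \<in> univ M. close b x y}" arbitrary: b rule: less_induct)
    case less
    have "\<exists>E\<in>entourage ` indices. E `` {x} \<subset> entourage b `` {x}"
      using visceral[unfolded visceral_def def_family_eq, THEN conjunct2, THEN conjunct1]
        less.prems(1) assms(2) by (simp only: ball_simps)
    then obtain c where c: "c \<in> indices" "entourage c `` {x} \<subset> entourage b `` {x}"
      by (rule bexE) (erule imageE, simp only:)
    note c = c(1) c(2)[unfolded entourage_Image[OF assms(2)]]
    show False
      by (rule less.hyps[OF psubset_card_mono[OF less.prems(2) c(2)] c(1)])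
         (rule finite_subset[OF psubset_imp_subset[OF c(2)] less.prems(2)])
  qed
qed

lemma openin_def_topology:
  "openin (def_topology M \<phi> \<psi>) U \<longleftrightarrow>
    U \<subseteq> univ M \<and> (\<forall>x\<in>U. \<exists>b\<in>indices. \<forall>y\<in>univ M. close b x y \<longrightarrow> y \<in> U)"
proof -
  have "(\<exists>D\<in>entourage ` indices. D `` {x} \<subseteq> U) \<longleftrightarrow> (\<exists>b\<in>indices. \<forall>y\<in>univ M. close b x y \<longrightarrow> y \<in> U)"
    if "x \<in> univ M" for x
  proof -
    have "entourage b `` {x} \<subseteq> U \<longleftrightarrow> (\<forall>y\<in>univ M. close b x y \<longrightarrow> y \<in> U)" for b
      unfolding entourage_Image[OF that] by blast
    then show ?thesis by simp
  qed
  then have "(\<forall>x\<in>U. \<exists>D\<in>entourage ` indices. D `` {x} \<subseteq> U) \<longleftrightarrow>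
      (\<forall>x\<in>U. \<exists>b\<in>indices. \<forall>y\<in>univ M. close b x y \<longrightarrow> y \<in> U)" if "U \<subseteq> univ M"
    by (rule ball_cong[OF refl]) (rule subsetD[OF that])
  then show ?thesis
    unfolding def_topology_def openin_uniform_topology[OF base] unfolding def_family_eq by (rule conj_cong[OF refl])
qed

lemma infinite_definable_ball:
  assumes "definable_pred (coords 1) (\<lambda>x. Q (x 0))" "infinite {t \<in> univ M. Q t}"
  shows "\<exists>t\<in>univ M. \<exists>b\<in>indices. \<forall>y\<in>univ M. close b t y \<longrightarrow> Q y"
proof -
  have "{x \<in> tuples (univ M) 1. x 0 \<in> {t \<in> univ M. Q t}} = {x \<in> tuples (univ M) 1. Q (x 0)}"
    by (auto simp: PiE_def Pi_def)
  then have "definable L M 1 {x \<in> tuples (univ M) 1. x 0 \<in> {t \<in> univ M. Q t}}"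
    using definableI[OF assms(1)] by (simp only:)
  then have "def_topology M \<phi> \<psi> interior_of {t \<in> univ M. Q t} \<noteq> {}"
    using visceral[unfolded visceral_def, THEN conjunct2, THEN conjunct2, rule_format,
        of "{t \<in> univ M. Q t}"] assms(2) by blast
  then obtain t where "t \<in> def_topology M \<phi> \<psi> interior_of {t \<in> univ M. Q t}" by blast
  then obtain U where U: "openin (def_topology M \<phi> \<psi>) U" "t \<in> U" "U \<subseteq> {t \<in> univ M. Q t}"
    unfolding interior_of_def by blast
  then obtain b where b: "b \<in> indices" "\<forall>y\<in>univ M. close b t y \<longrightarrow> y \<in> U" and "t \<in> univ M"
    unfolding openin_def_topology by blast
  moreover have "\<forall>y\<in>univ M. close b t y \<longrightarrow> Q y" using b(2) U(3) by blast
  ultimately show ?thesis by blast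
qed

lemma definable_pred_close:
  assumes "\<And>i. (\<lambda>x. h x i) \<in> C" "f \<in> C" "g \<in> C"
  shows "definable_pred C (\<lambda>x. close (h x) (f x) (g x))"
proof -
  have "(\<lambda>x. case_nat (f x) (case_nat (g x) (h x)) i) \<in> C" for i
  proof (cases i)
    case (Suc j)
    then show ?thesis using assms(1,3) by (cases j) simp_all
  qed (simp add: assms(2))
  then show ?thesis unfolding close_def by (intro definable_pred_sat formulas(1))
qed

section \<open>Boxes and interiors\<close>

definition near :: "nat \<Rightarrow> (nat \<Rightarrow> 'u) \<Rightarrow> (nat \<Rightarrow> 'u) \<Rightarrow> (nat \<Rightarrow> 'u) \<Rightarrow> bool" where
  "near k b w v \<longleftrightarrow> (\<forall>i<k. close b (w i) (v i))"

text \<open>One entourage for all coordinates is enough, as finitely many entourages have a common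
  refinement. Boxes need not be open; agreement with the topological interior is shown in
  \<open>interior_power_iff\<close>.\<close>

definition interior_at :: "nat \<Rightarrow> (nat \<Rightarrow> 'u) \<Rightarrow> ((nat \<Rightarrow> 'u) \<Rightarrow> bool) \<Rightarrow> bool" where
  "interior_at k w A \<longleftrightarrow> (\<exists>b\<in>indices. \<forall>v\<in>assignments. near k b w v \<longrightarrow> A v)"

definition has_interior :: "nat \<Rightarrow> ((nat \<Rightarrow> 'u) \<Rightarrow> bool) \<Rightarrow> bool" where
  "has_interior k A \<longleftrightarrow> (\<exists>w\<in>assignments. interior_at k w A)"

lemma definable_pred_near:
  assumes "\<And>i. (\<lambda>x. h x i) \<in> C" "\<And>i. i < k \<Longrightarrow> (\<lambda>x. f x i) \<in> C" "\<And>i. i < k \<Longrightarrow> (\<lambda>x. g x i) \<in> C"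
  shows "definable_pred C (\<lambda>x. near k (h x) (f x) (g x))"
  unfolding near_def using assms by (intro definable_pred_all_less definable_pred_close) auto

text \<open>The base is a definable family, so the index \<open>b\<close> of a box can be quantified
  like any parameter, subject to \<open>\<psi>\<close>.\<close>

lemma definable_pred_interior_at:
  assumes "definable_pred (ext_coords C) (\<lambda>p. A (fst p) (snd p))" "\<And>i. i < k \<Longrightarrow> (\<lambda>x. f x i) \<in> C"
  shows "definable_pred C (\<lambda>x. interior_at k (f x) (A x))"
proof -
  have eq: "interior_at k w B \<longleftrightarrow> (\<exists>b\<in>assignments. sat M b \<psi> \<and> (\<forall>v\<in>assignments. near k b w v \<longrightarrow> B v))" for w B
    unfolding interior_at_def indices_def by blast
  \<comment> \<open>Below the quantifiers over \<open>b\<close> and \<open>v\<close> the environment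
    is \<open>((x, b), v)\<close>, while \<open>A\<close> takes \<open>(x, v)\<close>.\<close>
  have "(\<lambda>q. g (fst (fst q), snd q)) \<in> ext_coords (ext_coords C)" if g: "g \<in> ext_coords C" for g
  proof -
    consider (old) f where "f \<in> C" "g = (\<lambda>p. f (fst p))" | (new) i where "g = (\<lambda>p. snd p i)"
      using g unfolding ext_coords_def by blast
    then show ?thesis
      by cases (simp_all add: ext_coords_fst[OF ext_coords_fst] ext_coords_snd)
  qed
  with definable_pred_subst[OF assms(1), of "\<lambda>q. (fst (fst q), snd q)" "ext_coords (ext_coords C)"]
  have A: "definable_pred (ext_coords (ext_coords C)) (\<lambda>q. A (fst (fst q)) (snd q))" by simp
  have f: "(\<lambda>q. f (fst (fst q)) i) \<in> ext_coords (ext_coords C)" if "i < k" for i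
    using ext_coords_fst[OF ext_coords_fst[OF assms(2)[OF that]]] .
  have b: "(\<lambda>q. snd (fst q) i) \<in> ext_coords (ext_coords C)" for i
    by (rule ext_coords_fst[OF ext_coords_snd])
  show ?thesis unfolding eq
    by (intro definable_pred_ex definable_pred_conj definable_pred_all definable_pred_imp A definable_pred_near definable_pred_sat formulas(2) ext_coords_snd f b)
qed

lemma near_refl: "b \<in> indices \<Longrightarrow> w \<in> assignments \<Longrightarrow> near k b w w"
  unfolding near_def by (simp add: close_refl assignments_app)

lemma near_Int:
  assumes "b \<in> indices" "b' \<in> indices"
  shows "\<exists>c\<in>indices. \<forall>k. \<forall>w\<in>assignments. \<forall>v\<in>assignments. near k c w v \<longrightarrow> near k b w v \<and> near k b' w v"
proof -
  obtain c where "c \<in> indices" "\<forall>x\<in>univ M. \<forall>y\<in>univ M. close c x y \<longrightarrow> close b x y \<and> close b' x y"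
    using indices_Int[OF assms] by blast
  then show ?thesis unfolding near_def using assignments_app by (intro bexI[of _ c]) blast+
qed

lemma has_interior_mono:
  "has_interior k A \<Longrightarrow> (\<And>v. v \<in> assignments \<Longrightarrow> A v \<Longrightarrow> A' v) \<Longrightarrow> has_interior k A'"
  unfolding has_interior_def interior_at_def by blast

lemma has_interiorI: "w \<in> assignments \<Longrightarrow> b \<in> indices \<Longrightarrow> (\<And>v. v \<in> assignments \<Longrightarrow> near k b w v \<Longrightarrow> A v) \<Longrightarrow> has_interior k A"
  unfolding has_interior_def interior_at_def by blast

lemma has_interiorE:
  assumes "has_interior k A"
  obtains w b where "w \<in> assignments" "b \<in> indices" "\<forall>v\<in>assignments. near k b w v \<longrightarrow> A v"
  using assms unfolding has_interior_def interior_at_def by blast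

lemma has_interior_nonempty: "has_interior k A \<Longrightarrow> \<exists>v\<in>assignments. A v"
  by (erule has_interiorE) (use near_refl in blast)

section \<open>Slabs over boxes and unions of sets without interior\<close>

lemma near_Suc_upd:
  "near (Suc k) b (w(k := t)) v \<longleftrightarrow> near k b w v \<and> close b t (v k)"
  unfolding near_def by (auto simp: less_Suc_eq)

lemma near_Suc: "near (Suc k) b w v \<longleftrightarrow> near k b w v \<and> close b (w k) (v k)"
  unfolding near_def by (auto simp: less_Suc_eq)

lemma near_upd: "near k b w (v(k := t)) \<longleftrightarrow> near k b w v"
  unfolding near_def by auto

text \<open>The centre and the index of a box are encoded in one sequence, the first \<open>k\<close> entries being the centre,
  in order to serve as parameters in \<open>uniform_finiteness\<close>.\<close>

lemma definable_pred_slab: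
  assumes "definable_pred (coords (Suc k)) A"
  shows "definable_pred (ext_coords all_coords)
    (\<lambda>p. \<forall>v\<in>assignments. near k (\<lambda>i. fst p (k + i)) (fst p) v \<longrightarrow> A (v(k := snd p 0)))"
proof -
  have "(\<lambda>p. ((snd p)(k := snd (fst p) 0)) i) \<in> ext_coords (ext_coords all_coords)" for i
    by (cases "i = k") (simp_all add: ext_coords_snd ext_coords_fst[OF ext_coords_snd])
  then have "definable_pred (ext_coords (ext_coords all_coords)) (\<lambda>p. A ((snd p)(k := snd (fst p) 0)))"
    by (intro definable_pred_coords_subst[OF assms] consts_ext_coords consts_all_coords)
  then show ?thesis
    by (intro definable_pred_all definable_pred_imp definable_pred_near ext_coords_snd ext_coords_fst[OF ext_coords_fst[OF all_coordsI(1)]])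
qed

text \<open>An infinite definable set of heights \<open>t\<close> contains a ball, and the product
  of that ball with the box around \<open>u\<close> contains a box.\<close>

lemma has_interior_slab:
  assumes A: "definable_pred (coords (Suc k)) A" and bu: "b \<in> indices" "u \<in> assignments"
    and inf: "infinite {t \<in> univ M. \<forall>v\<in>assignments. near k b u v \<longrightarrow> A (v(k := t))}"
  shows "has_interior (Suc k) A"
proof -
  define Q where "Q t \<longleftrightarrow> (\<forall>v\<in>assignments. near k b u v \<longrightarrow> A (v(k := t)))" for t
  have "definable_pred (coords 1) (\<lambda>x. \<forall>v\<in>assignments. near k b u v \<longrightarrow> A (v(k := x 0)))"
  proof (intro definable_pred_all definable_pred_imp)
    have "(\<lambda>p. ((snd p)(k := fst p 0)) i) \<in> ext_coords (coords 1)" for i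
      by (cases "i = k") (simp_all add: ext_coords_snd ext_coords_fst[OF coordsI(1)])
    then show "definable_pred (ext_coords (coords 1)) (\<lambda>p. A ((snd p)(k := fst p 0)))"
      by (intro definable_pred_coords_subst[OF A] consts_ext_coords consts_coords)
    show "definable_pred (ext_coords (coords 1)) (\<lambda>p. near k b u (snd p))"
      by (intro definable_pred_near ext_coords_snd ext_coords_fst[OF coordsI(2)] assignments_app indices_S bu)
  qed
  then have "\<exists>t\<in>univ M. \<exists>b'\<in>indices. \<forall>y\<in>univ M. close b' t y \<longrightarrow> Q y"
    using inf unfolding Q_def by (rule infinite_definable_ball)
  then obtain t b' where tb': "t \<in> univ M" "b' \<in> indices" "\<And>y. y \<in> univ M \<Longrightarrow> close b' t y \<Longrightarrow> Q y"
    by blast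
  obtain b'' where b'': "b'' \<in> indices"
    "\<And>x y. x \<in> univ M \<Longrightarrow> y \<in> univ M \<Longrightarrow> close b'' x y \<Longrightarrow> close b x y \<and> close b' x y"
    using indices_Int[OF bu(1) tb'(2)] by blast
  show ?thesis
  proof (rule has_interiorI[OF assignments_upd[OF bu(2) tb'(1)] b''(1)])
    fix v assume v: "v \<in> assignments" "near (Suc k) b'' (u(k := t)) v"
    then have *: "near k b'' u v" "close b'' t (v k)" by (simp_all only: near_Suc_upd)
    have "near k b u v"
      using *(1) b''(2)[OF assignments_app[OF bu(2)] assignments_app[OF v(1)]] by (simp add: near_def)
    moreover have "Q (v k)"
      using *(2) b''(2)[OF tb'(1) assignments_app[OF v(1)]] tb'(3)[OF assignments_app[OF v(1)]] by simp
    ultimately have "A (v(k := v k))" using v(1) unfolding Q_def by blast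
    then show "A v" by simp
  qed
qed

text \<open>Each of these sets of heights is finite by \<open>has_interior_slab\<close>;
  \<open>uniform_finiteness\<close> makes the bound independent of the box.\<close>

lemma slab_bound:
  assumes A: "definable_pred (coords (Suc k)) A" and nint: "\<not> has_interior (Suc k) A"
  shows "\<exists>N. \<forall>b\<in>indices. \<forall>u\<in>assignments.
    card {t \<in> univ M. \<forall>v\<in>assignments. near k b u v \<longrightarrow> A (v(k := t))} \<le> N"
proof -
  \<comment> \<open>The index of the box starts at entry \<open>k\<close>. Where it is not a valid
    index, the conjunct \<open>\<psi>\<close> makes the set empty, so that finiteness holds for all
    sequences.\<close>
  have "definable_pred (ext_coords all_coords) (\<lambda>p. sat M (\<lambda>i. fst p (k + i)) \<psi> \<and>
      (\<forall>v\<in>assignments. near k (\<lambda>i. fst p (k + i)) (fst p) v \<longrightarrow> A (v(k := snd p 0))))"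
    by (intro definable_pred_conj definable_pred_slab A definable_pred_sat formulas(2) ext_coords_fst[OF all_coordsI(1)])
  from saturated this have "\<exists>N. \<forall>c\<in>assignments. card {t \<in> univ M.
      sat M (\<lambda>i. c (k + i)) \<psi> \<and> (\<forall>v\<in>assignments. near k (\<lambda>i. c (k + i)) c v \<longrightarrow> A (v(k := t)))} \<le> N"
  proof (rule uniform_finiteness)
    fix c assume c: "c \<in> assignments"
    then have "(\<lambda>i. c (k + i)) \<in> assignments" by (auto simp: assignments_def)
    then have "(\<lambda>i. c (k + i)) \<in> indices" if "sat M (\<lambda>i. c (k + i)) \<psi>"
      using that by (simp add: indices_def)
    then show "finite {t \<in> univ M. sat M (\<lambda>i. c (k + i)) \<psi> \<and>
        (\<forall>v\<in>assignments. near k (\<lambda>i. c (k + i)) c v \<longrightarrow> A (v(k := t)))}"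
      using has_interior_slab[OF A _ c, of "\<lambda>i. c (k + i)"] nint
      by (cases "sat M (\<lambda>i. c (k + i)) \<psi>") auto
  qed
  then obtain N where N: "\<forall>c\<in>assignments. card {t \<in> univ M.
      sat M (\<lambda>i. c (k + i)) \<psi> \<and> (\<forall>v\<in>assignments. near k (\<lambda>i. c (k + i)) c v \<longrightarrow> A (v(k := t)))} \<le> N" ..
  have "card {t \<in> univ M. \<forall>v\<in>assignments. near k b u v \<longrightarrow> A (v(k := t))} \<le> N" if b: "b \<in> indices" and u: "u \<in> assignments" for b u
  proof -
    have c: "prepend k u b \<in> assignments"
      using b u indices_S by (intro assignmentsI) (simp add: prepend_def assignments_app)
    have eq: "(\<lambda>i. prepend k u b (k + i)) = b" by (simp add: prepend_def)
    have "near k b (prepend k u b) v \<longleftrightarrow> near k b u v" for v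
      unfolding near_def by (simp add: prepend_def)
    with bspec[OF N c] b show ?thesis by (simp add: eq indices_def)
  qed
  then show ?thesis by blast
qed

lemma definable_pred_fibre:
  assumes "definable_pred (coords (Suc k)) A" "t \<in> univ M"
  shows "definable_pred (coords k) (\<lambda>v. A (v(k := t)))"
proof -
  have "(\<lambda>v. (v(k := t)) i) \<in> coords k" if "i < Suc k" for i
    using that assms(2) by (cases "i = k") (simp_all add: coordsI)
  then show ?thesis by (intro definable_pred_coords_subst[OF assms(1)] consts_coords)
qed

lemma definable_pred_near_const:
  assumes "b \<in> assignments" "w \<in> assignments"
  shows "definable_pred (coords k) (near k b w)"
  using assms by (intro definable_pred_near coordsI assignments_app)

lemma has_interior_disj:
  "definable_pred (coords k) A \<Longrightarrow> definable_pred (coords k) A' \<Longrightarrow> has_interior k (\<lambda>v. A v \<or> A' v) \<Longrightarrow> has_interior k A \<or> has_interior k A'"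
proof (induction k arbitrary: A A')
  case 0
  obtain w b where w: "w \<in> assignments" "b \<in> indices" "\<forall>v\<in>assignments. near 0 b w v \<longrightarrow> A v \<or> A' v"
    using 0(3) by (rule has_interiorE)
  have "A w \<or> A' w" using w near_refl[OF w(2,1)] by blast
  \<comment> \<open>\<open>M\<^sup>0\<close> is a point: a definable predicate reading no
    coordinates is constant.\<close>
  moreover have "has_interior 0 B" if "definable_pred (coords 0) B" "B w" for B
    using that definable_pred_coords_cong[OF that(1), of _ w] by (intro has_interiorI[OF w(1,2)]) blast
  ultimately show ?case using 0(1,2) by blast
next
  case (Suc k)
  obtain w b where w: "w \<in> assignments" "b \<in> indices" "\<forall>v\<in>assignments. near (Suc k) b w v \<longrightarrow> A v \<or> A' v"
    using Suc.prems(3) by (rule has_interiorE)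
  show ?case
  proof (rule ccontr)
    assume "\<not> (has_interior (Suc k) A \<or> has_interior (Suc k) A')"
    then have nint: "\<not> has_interior (Suc k) A" "\<not> has_interior (Suc k) A'" by blast+
    obtain N N' where
      N: "\<forall>b\<in>indices. \<forall>u\<in>assignments. card {t \<in> univ M. \<forall>v\<in>assignments. near k b u v \<longrightarrow> A (v(k := t))} \<le> N" and
      N': "\<forall>b\<in>indices. \<forall>u\<in>assignments. card {t \<in> univ M. \<forall>v\<in>assignments. near k b u v \<longrightarrow> A' (v(k := t))} \<le> N'"
      using slab_bound[OF Suc.prems(1) nint(1)] slab_bound[OF Suc.prems(2) nint(2)] by blast
    \<comment> \<open>The induction hypothesis allows the box to be shrunk once for each height in
      \<open>T\<close>, until at each of these heights the slab over it lies entirely in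
      \<open>A\<close> or entirely in \<open>A'\<close>.\<close>
    have shrink: "\<exists>b'\<in>indices. \<exists>w'\<in>assignments. (\<forall>v\<in>assignments. near k b' w' v \<longrightarrow> near k b w v) \<and>
        (\<forall>t\<in>T. (\<forall>v\<in>assignments. near k b' w' v \<longrightarrow> A (v(k := t))) \<or> (\<forall>v\<in>assignments. near k b' w' v \<longrightarrow> A' (v(k := t))))"
      if "finite T" "T \<subseteq> {t \<in> univ M. close b (w k) t}" for T
      using that
    proof (induction T rule: finite_induct)
      case empty
      show ?case using w(1,2) by blast
    next
      case (insert t T)
      then have t: "t \<in> univ M" "close b (w k) t" by auto
      have "T \<subseteq> {t \<in> univ M. close b (w k) t}" using insert.prems by blast
      from insert.IH[OF this] obtain b' w' where b'w': "b' \<in> indices" "w' \<in> assignments" "\<forall>v\<in>assignments. near k b' w' v \<longrightarrow> near k b w v"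
        "\<forall>t\<in>T. (\<forall>v\<in>assignments. near k b' w' v \<longrightarrow> A (v(k := t))) \<or> (\<forall>v\<in>assignments. near k b' w' v \<longrightarrow> A' (v(k := t)))"
        by blast
      \<comment> \<open>The conjunct \<open>near k b' w' v\<close> keeps the new box inside the
        previous one, which preserves what was achieved for \<open>T\<close>.\<close>
      have D: "definable_pred (coords k) (\<lambda>v. near k b' w' v \<and> A (v(k := t)))"
        "definable_pred (coords k) (\<lambda>v. near k b' w' v \<and> A' (v(k := t)))"
        by (intro definable_pred_conj definable_pred_near_const indices_S b'w' definable_pred_fibre Suc.prems t)+
      have "has_interior k (\<lambda>v. (near k b' w' v \<and> A (v(k := t))) \<or> (near k b' w' v \<and> A' (v(k := t))))"
      proof (rule has_interiorI[OF b'w'(2,1)])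
        fix v assume v: "v \<in> assignments" "near k b' w' v"
        then have "near (Suc k) b w (v(k := t))"
          using b'w'(3) t(2) by (simp add: near_Suc near_upd)
        then show "(near k b' w' v \<and> A (v(k := t))) \<or> (near k b' w' v \<and> A' (v(k := t)))"
          using w(3) assignments_upd[OF v(1) t(1)] v(2) by blast
      qed
      then have disj: "has_interior k (\<lambda>v. near k b' w' v \<and> A (v(k := t))) \<or>
          has_interior k (\<lambda>v. near k b' w' v \<and> A' (v(k := t)))"
        by (rule Suc.IH[OF D])
      have box: "\<exists>b''\<in>indices. \<exists>w''\<in>assignments. (\<forall>v\<in>assignments. near k b'' w'' v \<longrightarrow> near k b' w' v) \<and>
          (\<forall>v\<in>assignments. near k b'' w'' v \<longrightarrow> Z v)" if Z: "has_interior k (\<lambda>v. near k b' w' v \<and> Z v)" for Z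
      proof -
        obtain w'' b'' where "w'' \<in> assignments" "b'' \<in> indices" "\<forall>v\<in>assignments. near k b'' w'' v \<longrightarrow> near k b' w' v \<and> Z v"
          using Z by (rule has_interiorE)
        then show ?thesis by blast
      qed
      obtain w'' b'' where wb: "w'' \<in> assignments" "b'' \<in> indices" "\<forall>v\<in>assignments. near k b'' w'' v \<longrightarrow> near k b' w' v"
        and t': "(\<forall>v\<in>assignments. near k b'' w'' v \<longrightarrow> A (v(k := t))) \<or>
          (\<forall>v\<in>assignments. near k b'' w'' v \<longrightarrow> A' (v(k := t)))"
        using disj box[of "\<lambda>v. A (v(k := t))"] box[of "\<lambda>v. A' (v(k := t))"] by blast
      have "\<forall>v\<in>assignments. near k b'' w'' v \<longrightarrow> near k b w v"
        using wb(3) b'w'(3) by blast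
      moreover have "(\<forall>v\<in>assignments. near k b'' w'' v \<longrightarrow> A (v(k := s))) \<or>
          (\<forall>v\<in>assignments. near k b'' w'' v \<longrightarrow> A' (v(k := s)))" if "s \<in> insert t T" for s
      proof (cases "s = t")
        case False
        with that b'w'(4) show ?thesis using wb(3) by blast
      qed (use t' in simp)
      ultimately show ?case using wb(1,2) by blast
    qed
    \<comment> \<open>One more height than the two bounds together allow; the ball is infinite and
      supplies them.\<close>
    obtain T where T: "finite T" "card T = N + N' + 1" "T \<subseteq> {t \<in> univ M. close b (w k) t}"
      using infinite_arbitrarily_large[OF infinite_ball[OF w(2) assignments_app[OF w(1)]]] by blast
    obtain b' w' where b'w': "b' \<in> indices" "w' \<in> assignments"
      "\<forall>t\<in>T. (\<forall>v\<in>assignments. near k b' w' v \<longrightarrow> A (v(k := t))) \<or> (\<forall>v\<in>assignments. near k b' w' v \<longrightarrow> A' (v(k := t)))"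
      using shrink[OF T(1,3)] by blast
    let ?X = "{t \<in> univ M. \<forall>v\<in>assignments. near k b' w' v \<longrightarrow> A (v(k := t))}"
    let ?X' = "{t \<in> univ M. \<forall>v\<in>assignments. near k b' w' v \<longrightarrow> A' (v(k := t))}"
    have "finite ?X" "finite ?X'"
      using has_interior_slab[OF Suc.prems(1) b'w'(1,2)] has_interior_slab[OF Suc.prems(2) b'w'(1,2)] nint by blast+
    then have "card T \<le> card (?X \<union> ?X')"
      using b'w'(3) T(3) by (intro card_mono) auto
    also have "\<dots> \<le> card ?X + card ?X'" by (rule card_Un_le)
    also have "\<dots> \<le> N + N'" using N N' b'w' by (intro add_mono) blast+
    finally show False using T(2) by simp
  qed
qed

section \<open>Comparison with the product topology\<close>

lemma interior_power_iff:
  assumes Y: "Y \<subseteq> tuples (univ M) k"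
  shows "power_topology (def_topology M \<phi> \<psi>) k interior_of Y \<noteq> {} \<longleftrightarrow>
    has_interior k (\<lambda>z. restrict z {..<k} \<in> Y)"
proof
  assume "power_topology (def_topology M \<phi> \<psi>) k interior_of Y \<noteq> {}"
  then obtain x U where U: "openin (power_topology (def_topology M \<phi> \<psi>) k) U" "x \<in> U" "U \<subseteq> Y"
    unfolding interior_of_def by blast
  from U(1) have "\<forall>x\<in>U. \<exists>V. finite {i \<in> {..<k}. V i \<noteq> topspace (def_topology M \<phi> \<psi>)} \<and>
      (\<forall>i\<in>{..<k}. openin (def_topology M \<phi> \<psi>) (V i)) \<and> x \<in> Pi\<^sub>E {..<k} V \<and> Pi\<^sub>E {..<k} V \<subseteq> U"
    unfolding power_topology_def openin_product_topology_alt .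
  from bspec[OF this U(2)] obtain V where V: "\<And>i. i < k \<Longrightarrow> openin (def_topology M \<phi> \<psi>) (V i)"
    "x \<in> Pi\<^sub>E {..<k} V" "Pi\<^sub>E {..<k} V \<subseteq> U"
    by (meson lessThan_iff)
  have x: "x \<in> tuples (univ M) k" using U Y by blast
  \<comment> \<open>Successive common refinement yields one index that works for the first
    \<open>m\<close> open factors \<open>V i\<close>.\<close>
  have "\<exists>b\<in>indices. \<forall>i<m. \<forall>y\<in>univ M. close b (x i) y \<longrightarrow> y \<in> V i" if "m \<le> k" for m
    using that
  proof (induction m)
    case 0
    then show ?case using indices_nonempty by simp
  next
    case (Suc m)
    have "m \<le> k" using Suc.prems by simp
    from Suc.IH[OF this] obtain b where
      b: "b \<in> indices" "\<forall>i<m. \<forall>y\<in>univ M. close b (x i) y \<longrightarrow> y \<in> V i" by blast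
    have "x m \<in> V m" using V(2) Suc.prems by (simp add: PiE_iff)
    moreover have "openin (def_topology M \<phi> \<psi>) (V m)" using V(1) Suc.prems by simp
    ultimately obtain b' where b': "b' \<in> indices" "\<forall>y\<in>univ M. close b' (x m) y \<longrightarrow> y \<in> V m"
      unfolding openin_def_topology by blast
    obtain c where c: "c \<in> indices" "\<forall>x\<in>univ M. \<forall>y\<in>univ M. close c x y \<longrightarrow> close b x y \<and> close b' x y"
      using indices_Int[OF b(1) b'(1)] by blast
    have "y \<in> V i" if "i < Suc m" "y \<in> univ M" "close c (x i) y" for i y
    proof -
      have "x i \<in> univ M" using x that(1) Suc.prems by (simp add: PiE_iff)
      then have "close b (x i) y" "close b' (x i) y" using c(2) that by blast+
      then show ?thesis using b(2) b'(2) that by (cases "i = m") simp_all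
    qed
    then show ?case using c(1) by blast
  qed
  then obtain b where b: "b \<in> indices" "\<forall>i<k. \<forall>y\<in>univ M. close b (x i) y \<longrightarrow> y \<in> V i" by blast
  show "has_interior k (\<lambda>z. restrict z {..<k} \<in> Y)"
  proof (rule has_interiorI[OF pad_tuples[OF x] b(1)])
    fix z assume z: "z \<in> assignments" "near k b (pad k x) z"
    have "z i \<in> V i" if "i < k" for i
      using b(2) that z(2) assignments_app[OF z(1)] unfolding near_def by (simp add: pad_less)
    then have "restrict z {..<k} \<in> Pi\<^sub>E {..<k} V" by simp
    then show "restrict z {..<k} \<in> Y" using V(3) U(3) by blast
  qed
next
  assume "has_interior k (\<lambda>z. restrict z {..<k} \<in> Y)"
  then obtain w b where w: "w \<in> assignments" "b \<in> indices" "\<forall>v\<in>assignments. near k b w v \<longrightarrow> restrict v {..<k} \<in> Y"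
    by (rule has_interiorE)
  \<comment> \<open>Balls need not be open, so \<open>V i\<close> is the interior of the ball about
    \<open>w i\<close>; its openness comes from \<open>close_comp\<close>.\<close>
  define V where "V i = {y \<in> univ M. \<exists>c\<in>indices. \<forall>y'\<in>univ M. close c y y' \<longrightarrow> close b (w i) y'}" for i
  have "openin (def_topology M \<phi> \<psi>) (V i)" for i
    unfolding openin_def_topology
  proof (intro conjI ballI)
    show "V i \<subseteq> univ M" by (auto simp: V_def)
    fix y assume "y \<in> V i"
    then obtain c where c: "c \<in> indices" "y \<in> univ M" "\<forall>y'\<in>univ M. close c y y' \<longrightarrow> close b (w i) y'"
      unfolding V_def by blast
    obtain d where d: "d \<in> indices"
      "\<forall>x\<in>univ M. \<forall>y\<in>univ M. \<forall>z\<in>univ M. close d x y \<longrightarrow> close d y z \<longrightarrow> close c x z"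
      using close_comp[OF c(1)] by blast
    have "y' \<in> V i" if "y' \<in> univ M" "close d y y'" for y'
      unfolding V_def using that c d by blast
    then show "\<exists>b\<in>indices. \<forall>y'\<in>univ M. close b y y' \<longrightarrow> y' \<in> V i" using d(1) by blast
  qed
  then have "openin (power_topology (def_topology M \<phi> \<psi>) k) (Pi\<^sub>E {..<k} V)"
    unfolding power_topology_def by (simp add: openin_PiE)
  moreover have "Pi\<^sub>E {..<k} V \<subseteq> Y"
  proof
    fix x assume x: "x \<in> Pi\<^sub>E {..<k} V"
    have xV: "x i \<in> univ M \<and> close b (w i) (x i)" if "i < k" for i
    proof -
      have "x i \<in> V i" using x that by (simp add: PiE_iff)
      then show ?thesis unfolding V_def using close_refl by blast
    qed
    then have "near k b w (pad k x)" unfolding near_def by (simp add: pad_less)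
    moreover have "pad k x \<in> assignments" by (rule pad_S) (simp add: xV)
    ultimately have "restrict (pad k x) {..<k} \<in> Y" using w(3) by blast
    moreover have "restrict x {..<k} = x" using x by (rule PiE_restrict)
    ultimately show "x \<in> Y" by (simp add: restrict_pad)
  qed
  moreover have "restrict w {..<k} \<in> Pi\<^sub>E {..<k} V"
  proof -
    have "w i \<in> V i" for i unfolding V_def using assignments_app[OF w(1)] w(2) by blast
    then show ?thesis by simp
  qed
  ultimately show "power_topology (def_topology M \<phi> \<psi>) k interior_of Y \<noteq> {}"
    unfolding interior_of_def by blast
qed

section \<open>Sets without interior and finite fibres\<close>

lemma interior_at_cong: "(\<And>i. i < k \<Longrightarrow> w i = w' i) \<Longrightarrow> interior_at k w A \<longleftrightarrow> interior_at k w' A"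
  unfolding interior_at_def near_def by simp

text \<open>The box in the fibre may depend on \<open>t\<close>. Finitely many values of
  \<open>t\<close> have a common box around \<open>u\<close>, by refinement, so
  \<open>slab_bound\<close> limits their number.\<close>

lemma finite_interior_at_fibres:
  assumes Z: "definable_pred (coords (Suc m)) Z" "\<not> has_interior (Suc m) Z" and u: "u \<in> assignments"
  shows "finite {t \<in> univ M. interior_at m u (\<lambda>v. Z (v(m := t)))}"
proof (rule ccontr)
  assume inf: "infinite {t \<in> univ M. interior_at m u (\<lambda>v. Z (v(m := t)))}"
  obtain N where N: "\<forall>b\<in>indices. \<forall>u\<in>assignments.
      card {t \<in> univ M. \<forall>v\<in>assignments. near m b u v \<longrightarrow> Z (v(m := t))} \<le> N"
    using slab_bound[OF Z] by blast
  obtain T where T: "finite T" "card T = Suc N"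
    "T \<subseteq> {t \<in> univ M. interior_at m u (\<lambda>v. Z (v(m := t)))}"
    using infinite_arbitrarily_large[OF inf] by blast
  have "\<exists>b\<in>indices. \<forall>t\<in>T. \<forall>v\<in>assignments. near m b u v \<longrightarrow> Z (v(m := t))"
    using T(1,3)
  proof (induction T rule: finite_induct)
    case empty
    then show ?case using indices_nonempty by blast
  next
    case (insert t T)
    then obtain b where b: "b \<in> indices" "\<forall>t\<in>T. \<forall>v\<in>assignments. near m b u v \<longrightarrow> Z (v(m := t))" by blast
    obtain b' where b': "b' \<in> indices" "\<forall>v\<in>assignments. near m b' u v \<longrightarrow> Z (v(m := t))"
      using insert.prems unfolding interior_at_def by blast
    obtain c where c: "c \<in> indices" "\<forall>k. \<forall>w\<in>assignments. \<forall>v\<in>assignments. near k c w v \<longrightarrow> near k b w v \<and> near k b' w v"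
      using near_Int[OF b(1) b'(1)] by blast
    have c': "near m b u v \<and> near m b' u v" if "v \<in> assignments" "near m c u v" for v
      using c(2) u that by blast
    have "\<forall>s\<in>insert t T. \<forall>v\<in>assignments. near m c u v \<longrightarrow> Z (v(m := s))"
      using b(2) b'(2) c' by blast
    then show ?case using c(1) by blast
  qed
  then obtain b where b: "b \<in> indices" "\<forall>t\<in>T. \<forall>v\<in>assignments. near m b u v \<longrightarrow> Z (v(m := t))" by blast
  let ?X = "{t \<in> univ M. \<forall>v\<in>assignments. near m b u v \<longrightarrow> Z (v(m := t))}"
  have "finite ?X" using has_interior_slab[OF Z(1) b(1) u] Z(2) by blast
  moreover have "T \<subseteq> ?X" using b(2) T(3) by blast
  ultimately have "card T \<le> card ?X" by (rule card_mono)
  also have "\<dots> \<le> N" using N b(1) u by blast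
  finally show False using T(2) by simp
qed

lemma definable_pred_image:
  assumes "definable_pred (coords n) A" "definable_pred (coords2 n k) (\<lambda>p. R (fst p) (snd p))"
  shows "definable_pred (coords k) (\<lambda>z. \<exists>a\<in>assignments. A a \<and> R a z)"
proof (intro definable_pred_ex definable_pred_conj)
  show "definable_pred (ext_coords (coords k)) (\<lambda>p. A (snd p))"
    by (rule definable_pred_coords_subst[OF assms(1)]) (rule ext_coords_snd consts_ext_coords consts_coords)+
  show "definable_pred (ext_coords (coords k)) (\<lambda>p. R (snd p) (fst p))"
    by (rule definable_pred_coords2_subst[OF assms(2)]) (rule ext_coords_snd ext_coords_fst coordsI consts_ext_coords consts_coords | assumption)+
qed

text \<open>The image of a union is the union of the images, to which
  \<open>has_interior_disj\<close> applies.\<close>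

lemma has_interior_image_disj:
  assumes "definable_pred (coords n) A" "definable_pred (coords n) B" "definable_pred (coords2 n k) (\<lambda>p. R (fst p) (snd p))"
    and "has_interior k (\<lambda>z. \<exists>a\<in>assignments. (A a \<or> B a) \<and> R a z)"
  shows "has_interior k (\<lambda>z. \<exists>a\<in>assignments. A a \<and> R a z) \<or> has_interior k (\<lambda>z. \<exists>a\<in>assignments. B a \<and> R a z)"
  by (rule has_interior_disj[OF definable_pred_image[OF assms(1,3)] definable_pred_image[OF assms(2,3)]],
      rule has_interior_mono[OF assms(4)]) blast

text \<open>The fibres of \<open>A\<close> over the coordinates \<open>\<ge> m\<close> have no interior. Split off the points \<open>y\<close> of \<open>A\<close> lying
  in the interior of the fibre over the coordinates \<open>\<ge> m - 1\<close> of \<open>y\<close>: they have finite fibres in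
  coordinate \<open>m - 1\<close>, and the fibres of the rest over the coordinates \<open>\<ge> m - 1\<close> have no interior.\<close>

lemma exists_finite_fibre_piece:
  assumes R: "definable_pred (coords2 n k) (\<lambda>p. R (fst p) (snd p))"
  shows "m \<le> n \<Longrightarrow> definable_pred (coords n) A \<Longrightarrow> \<forall>y\<in>assignments. \<not> has_interior m (\<lambda>u. A (merge_at m u y)) \<Longrightarrow>
    has_interior k (\<lambda>z. \<exists>a\<in>assignments. A a \<and> R a z) \<Longrightarrow>
    \<exists>j<n. \<exists>A'. definable_pred (coords n) A' \<and> (\<forall>y\<in>assignments. finite {t \<in> univ M. A' (y(j := t))}) \<and>
      has_interior k (\<lambda>z. \<exists>a\<in>assignments. A' a \<and> R a z)"
proof (induction m arbitrary: A)
  case 0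
  \<comment> \<open>For \<open>m = 0\<close> a nonempty fibre is a point and has interior, so
    \<open>A\<close> would have to be empty.\<close>
  obtain a where a: "a \<in> assignments" "A a" using has_interior_nonempty[OF 0(4)] by blast
  obtain b where b: "b \<in> indices" using indices_nonempty by blast
  have "has_interior 0 (\<lambda>u. A (merge_at 0 u a))"
    by (rule has_interiorI[OF a(1) b]) (simp add: merge_at_def a(2))
  then show ?case using 0(3) a(1) by blast
next
  case (Suc m)
  \<comment> \<open>The map \<open>\<lambda>u. merge_at m u y\<close> parametrizes the fibre through
    \<open>y\<close> over the coordinates from \<open>m\<close> on; \<open>I\<close> holds at the
    points around which that fibre contains a box.\<close>
  define I where "I y \<longleftrightarrow> interior_at m y (\<lambda>u. A (merge_at m u y))" for y
  have "(\<lambda>p. merge_at m (snd p) (fst p) i) \<in> ext_coords (coords n)" if "i < n" for i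
    by (cases "i < m") (simp_all add: merge_at_def ext_coords_snd ext_coords_fst[OF coordsI(1)] that)
  then have "definable_pred (ext_coords (coords n)) (\<lambda>p. A (merge_at m (snd p) (fst p)))"
    by (rule definable_pred_coords_subst[OF Suc.prems(2)]) (rule consts_ext_coords consts_coords | assumption)+
  then have I: "definable_pred (coords n) I" unfolding I_def
    by (rule definable_pred_interior_at) (rule coordsI, use Suc.prems(1) in simp)
  have D: "definable_pred (coords n) (\<lambda>y. A y \<and> I y)" "definable_pred (coords n) (\<lambda>y. A y \<and> \<not> I y)"
    by (intro definable_pred_conj definable_pred_not Suc.prems(2) I)+
  have "has_interior k (\<lambda>z. \<exists>a\<in>assignments. ((A a \<and> I a) \<or> (A a \<and> \<not> I a)) \<and> R a z)"
    by (rule has_interior_mono[OF Suc.prems(4)]) blast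
  from has_interior_image_disj[OF D R this] show ?case
  proof
    assume hi: "has_interior k (\<lambda>z. \<exists>a\<in>assignments. (A a \<and> I a) \<and> R a z)"
    have "finite {t \<in> univ M. A (y(m := t)) \<and> I (y(m := t))}" if y: "y \<in> assignments" for y
    proof -
      \<comment> \<open>\<open>Z\<close> is the fibre over the coordinates of \<open>y\<close> from
        \<open>Suc m\<close> on, and \<open>I (y(m := t))\<close> concerns its part at height
        \<open>t\<close>.\<close>
      define Z where "Z v \<longleftrightarrow> A (merge_at (Suc m) v y)" for v
      have "(\<lambda>v. merge_at (Suc m) v y i) \<in> coords (Suc m)" for i
        by (cases "i < Suc m") (simp_all add: merge_at_def coordsI assignments_app[OF y])
      then have "definable_pred (coords (Suc m)) Z" unfolding Z_def
        by (rule definable_pred_coords_subst[OF Suc.prems(2)]) (rule consts_coords)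
      moreover have "\<not> has_interior (Suc m) Z" unfolding Z_def using Suc.prems(3) y by blast
      ultimately have fin: "finite {t \<in> univ M. interior_at m y (\<lambda>v. Z (v(m := t)))}"
        using y by (rule finite_interior_at_fibres)
      have "I (y(m := t)) \<longleftrightarrow> interior_at m y (\<lambda>v. Z (v(m := t)))" for t
      proof -
        have "merge_at (Suc m) (v(m := t)) y = merge_at m v (y(m := t))" for v
          by (auto simp: merge_at_def fun_eq_iff less_Suc_eq)
        then show ?thesis unfolding I_def Z_def
          using interior_at_cong[of m "y(m := t)" y] by simp
      qed
      then show ?thesis by (intro finite_subset[OF _ fin]) blast
    qed
    then show ?thesis using D(1) hi Suc.prems(1) Suc_le_lessD by blast
  next
    assume hi: "has_interior k (\<lambda>z. \<exists>a\<in>assignments. (A a \<and> \<not> I a) \<and> R a z)"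
    have "\<not> has_interior m (\<lambda>u. A (merge_at m u y) \<and> \<not> I (merge_at m u y))" if y: "y \<in> assignments" for y
    proof
      assume "has_interior m (\<lambda>u. A (merge_at m u y) \<and> \<not> I (merge_at m u y))"
      then obtain w b where w: "w \<in> assignments" "b \<in> indices"
        "\<forall>v\<in>assignments. near m b w v \<longrightarrow> A (merge_at m v y) \<and> \<not> I (merge_at m v y)" by (rule has_interiorE)
      \<comment> \<open>All points of the box share one fibre, so the box would witness
        \<open>I\<close> at its own centre.\<close>
      have "merge_at m u (merge_at m w y) = merge_at m u y" for u by (simp add: merge_at_def fun_eq_iff)
      then have "I (merge_at m w y) \<longleftrightarrow> interior_at m w (\<lambda>u. A (merge_at m u y))"
        unfolding I_def using interior_at_cong[of m "merge_at m w y" w] by (simp add: merge_at_def)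
      moreover have "interior_at m w (\<lambda>u. A (merge_at m u y))" unfolding interior_at_def using w(2,3) by blast
      ultimately show False using w(3) w(1) near_refl[OF w(2,1)] by blast
    qed
    then show ?thesis using Suc.IH[OF _ D(2) _ hi] Suc.prems(1) by simp
  qed
qed

end

section \<open>Dimension\<close>

definition skip :: "nat \<Rightarrow> nat \<Rightarrow> nat" where
  "skip j i = (if i < j then i else Suc i)"

lemma skip_less: "i < n \<Longrightarrow> skip j i < Suc n"
  by (simp add: skip_def)

lemma skip_neq: "skip j i \<noteq> j"
  by (simp add: skip_def)

lemma skip_surj:
  assumes "i < Suc n" "i \<noteq> j" "j \<le> n"
  obtains i' where "i' < n" "skip j i' = i"
proof (cases "i < j")
  case True
  with assms show ?thesis by (intro that[of i]) (simp_all add: skip_def)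
next
  case False
  with assms show ?thesis by (intro that[of "i - 1"]) (auto simp: skip_def)
qed

lemma strict_mono_skip: "strict_mono (skip j)"
  by (auto simp: strict_mono_def skip_def)

text \<open>\<open>skip j\<close> enumerates the positions other than \<open>j\<close>, so
  precomposing with it forgets coordinate \<open>j\<close>; \<open>ins j\<close> reverses
  this.\<close>

definition ins :: "nat \<Rightarrow> (nat \<Rightarrow> 'u) \<Rightarrow> 'u \<Rightarrow> nat \<Rightarrow> 'u" where
  "ins j u t = (\<lambda>i. if i < j then u i else if i = j then t else u (i - 1))"

lemma ins_skip: "ins j u t (skip j i) = u i"
  by (simp add: ins_def skip_def)

lemma ins_same: "ins j (\<lambda>i. y (skip j i)) (y j) = y"
  by (auto simp: ins_def skip_def fun_eq_iff)

lemma ins_upd: "(ins j u t)(j := t') = ins j u t'"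
  by (auto simp: ins_def fun_eq_iff)

section \<open>Injective pieces and definable images\<close>

locale tame_structure = visceral_structure L M \<phi> \<psi>
  for L :: "('f, 'r) language" and M :: "('f, 'r, 'u) fo_struct" and \<phi> \<psi> :: "('f, 'r) formula" +
  assumes finite_choice: "\<And>m n X f. definable_map L M m X n (tuples (univ M) n) f \<Longrightarrow>
      (\<And>y. y \<in> f ` X \<Longrightarrow> finite {x \<in> X. f x = y}) \<Longrightarrow>
      \<exists>\<sigma>. definable_map L M n (f ` X) m X \<sigma> \<and> (\<forall>y\<in>f ` X. f (\<sigma> y) = y)"
    and no_filling: "\<And>m n X f. m < n \<Longrightarrow> definable_map L M m X n (f ` X) f \<Longrightarrow>
      power_topology (def_topology M \<phi> \<psi>) n interior_of (f ` X) = {}"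
begin

lemma ins_S: "u \<in> assignments \<Longrightarrow> t \<in> univ M \<Longrightarrow> ins j u t \<in> assignments"
  by (intro assignmentsI) (simp add: ins_def assignments_app)

text \<open>Definable finite choice is applied to the projection of \<open>A\<close> that forgets
  coordinate \<open>j\<close>. The image of the section, one point from each nonempty fibre, is
  \<open>A'\<close>.\<close>

lemma finite_choice_piece:
  assumes A: "definable_pred (coords (Suc n)) A" and j: "j \<le> n"
    and fin: "\<forall>y\<in>assignments. finite {t \<in> univ M. A (y(j := t))}"
  shows "\<exists>A'. definable_pred (coords (Suc n)) A' \<and> (\<forall>a. A' a \<longrightarrow> A a) \<and>
    (\<forall>y\<in>assignments. \<forall>t\<in>univ M. \<forall>t'\<in>univ M. A' (y(j := t)) \<longrightarrow> A' (y(j := t')) \<longrightarrow> t = t') \<and>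
    (\<forall>y\<in>assignments. A y \<longrightarrow> (\<exists>t\<in>univ M. A' (y(j := t))))"
proof -
  define X where "X = {x \<in> tuples (univ M) (Suc n). A x}"
  define f where "f x = restrict (\<lambda>i. x (skip j i)) {..<n}" for x :: "nat \<Rightarrow> 'u"
  have X: "X \<subseteq> tuples (univ M) (Suc n)" by (simp add: X_def)
  have f: "f \<in> X \<rightarrow> tuples (univ M) n"
  proof
    fix x assume "x \<in> X"
    then have "x i \<in> univ M" if "i < Suc n" for i using that by (simp add: X_def PiE_iff)
    then show "f x \<in> tuples (univ M) n" unfolding f_def restrict_tuples by (simp add: skip_less)
  qed
  have A_restrict: "A (restrict x {..<Suc n}) \<longleftrightarrow> A x" for x
    by (rule definable_pred_coords_cong[OF A]) simp
  have X_iff: "restrict x {..<Suc n} \<in> X \<longleftrightarrow> (\<forall>i<Suc n. x i \<in> univ M) \<and> A x" for x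
    unfolding X_def using A_restrict[of x] restrict_tuples[of x "Suc n"] by simp
  have f_restrict: "f (restrict x {..<Suc n}) = restrict (\<lambda>i. x (skip j i)) {..<n}" for x
    unfolding f_def restrict_eq_iff by (simp add: skip_less)
  have "definable_pred (coords2 (Suc n) n) (\<lambda>p. ((\<forall>i<Suc n. fst p i \<in> univ M) \<and> A (fst p)) \<and>
      (\<forall>i<n. fst p (skip j i) = snd p i))"
  proof (intro definable_pred_conj definable_pred_all_less)
    show "definable_pred (coords2 (Suc n) n) (\<lambda>p. A (fst p))"
      by (rule definable_pred_coords_subst[OF A]) (rule coords2I consts_coords | assumption)+
    show "definable_pred (coords2 (Suc n) n) (\<lambda>p. fst p (skip j i) = snd p i)" if "i < n" for i
      by (rule definable_pred_eq) (rule coords2I skip_less that)+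
    show "definable_pred (coords2 (Suc n) n) (\<lambda>p. fst p i \<in> univ M)" if "i < Suc n" for i
      by (rule definable_pred_univ) (rule coords2I that)+
  qed
  then have "definable L M (Suc n + n) (graph_on (Suc n) n X f)"
    unfolding definable_graph_iff[OF X f] X_iff f_restrict restrict_eq_iff .
  then have map: "definable_map L M (Suc n) X n (tuples (univ M) n) f"
    unfolding definable_map_def using X f by simp
  have "finite {x \<in> X. f x = y}" if y: "y \<in> f ` X" for y
  proof -
    obtain x0 where x0: "x0 \<in> X" "f x0 = y" using y by blast
    have x0S: "pad (Suc n) x0 \<in> assignments" using x0(1) X by (intro pad_tuples) blast
    have eq: "x i = x0 i" if x: "x \<in> X" "f x = y" and i: "i < Suc n" "i \<noteq> j" for x i
    proof -
      obtain i' where i': "i' < n" "skip j i' = i" using skip_surj[OF i j] .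
      have "f x = f x0" using x(2) x0(2) by simp
      then show ?thesis unfolding f_def restrict_eq_iff using i' by blast
    qed
    \<comment> \<open>Points in one fibre of \<open>f\<close> differ at most in coordinate
      \<open>j\<close>, so this coordinate embeds the fibre into a finite set.\<close>
    have "(\<lambda>x. x j) ` {x \<in> X. f x = y} \<subseteq> {t \<in> univ M. A ((pad (Suc n) x0)(j := t))}"
    proof (rule image_subsetI)
      fix x assume "x \<in> {x \<in> X. f x = y}"
      then have x: "x \<in> X" "f x = y" by simp_all
      have "((pad (Suc n) x0)(j := x j)) i = x i" if "i < Suc n" for i
        using eq[OF x that] that by (simp add: pad_def)
      then have "A ((pad (Suc n) x0)(j := x j)) \<longleftrightarrow> A x" by (rule definable_pred_coords_cong[OF A])
      moreover have "A x" "x j \<in> univ M" using x(1) j by (simp_all add: X_def PiE_iff)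
      ultimately show "x j \<in> {t \<in> univ M. A ((pad (Suc n) x0)(j := t))}" by simp
    qed
    then have "finite ((\<lambda>x. x j) ` {x \<in> X. f x = y})"
      by (rule finite_subset) (rule bspec[OF fin x0S])
    moreover have "inj_on (\<lambda>x. x j) {x \<in> X. f x = y}"
    proof (rule inj_onI)
      fix x x' assume h: "x \<in> {x \<in> X. f x = y}" "x' \<in> {x \<in> X. f x = y}" "x j = x' j"
      then have x: "x \<in> X" "f x = y" "x' \<in> X" "f x' = y" by simp_all
      have "x i = x' i" if "i < Suc n" for i
        using eq[OF x(1,2) that] eq[OF x(3,4) that] h(3) by (cases "i = j") simp_all
      moreover have "x \<in> extensional {..<Suc n}" "x' \<in> extensional {..<Suc n}"
        using x(1,3) X by (auto simp: PiE_def)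
      ultimately show "x = x'" by (intro extensionalityI[of x "{..<Suc n}" x']) simp_all
    qed
    ultimately show ?thesis by (rule finite_imageD)
  qed
  from finite_choice[OF map this] obtain \<sigma> where \<sigma>: "definable_map L M n (f ` X) (Suc n) X \<sigma>"
    "\<And>y. y \<in> f ` X \<Longrightarrow> f (\<sigma> y) = y" by blast
  define G where "G u a \<longleftrightarrow> restrict u {..<n} \<in> f ` X \<and> \<sigma> (restrict u {..<n}) = restrict a {..<Suc n}"
    for u a :: "nat \<Rightarrow> 'u"
  have fX: "f ` X \<subseteq> tuples (univ M) n" using f by blast
  have \<sigma>X: "\<sigma> \<in> f ` X \<rightarrow> X" using \<sigma>(1) by (simp add: definable_map_def)
  then have "\<sigma> \<in> f ` X \<rightarrow> tuples (univ M) (Suc n)" using X by blast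
  from definable_graph_iff[OF fX this] have G: "definable_pred (coords2 n (Suc n)) (\<lambda>p. G (fst p) (snd p))"
    using \<sigma>(1) unfolding G_def definable_map_def by blast
  \<comment> \<open>The points of \<open>A\<close> that \<open>\<sigma>\<close> chooses over their
    own projection.\<close>
  define A' where "A' a \<longleftrightarrow> A a \<and> G (\<lambda>i. a (skip j i)) a" for a
  show ?thesis
  proof (intro exI[of _ A'] conjI allI ballI impI)
    show "definable_pred (coords (Suc n)) A'" unfolding A'_def
      by (intro definable_pred_conj A, rule definable_pred_coords2_subst[OF G])
        (rule coordsI skip_less consts_coords | assumption)+
    show "A a" if "A' a" for a using that by (simp add: A'_def)
    fix y assume y: "y \<in> assignments"
    have sk: "(\<lambda>i. (y(j := t)) (skip j i)) = (\<lambda>i. y (skip j i))" for t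
      by (simp add: skip_neq)
    show "t = t'" if "A' (y(j := t))" "A' (y(j := t'))" for t t'
    proof -
      have "restrict (y(j := t)) {..<Suc n} = restrict (y(j := t')) {..<Suc n}"
        using that unfolding A'_def G_def sk by simp
      then have "(y(j := t)) j = (y(j := t')) j"
        unfolding restrict_eq_iff using le_imp_less_Suc[OF j] by blast
      then show ?thesis by simp
    qed
    assume "A y"
    then have "restrict y {..<Suc n} \<in> X" unfolding X_iff using assignments_app[OF y] by simp
    moreover define u where "u = f (restrict y {..<Suc n})"
    ultimately have u: "u \<in> f ` X" by blast
    \<comment> \<open>The witness is coordinate \<open>j\<close> of the point chosen in the fibre
      through \<open>y\<close>.\<close>
    define t where "t = \<sigma> u j"
    have \<sigma>u: "\<sigma> u \<in> X" "f (\<sigma> u) = u" using \<sigma>X \<sigma>(2) u by blast+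
    have t: "t \<in> univ M" unfolding t_def using \<sigma>u(1) j by (simp add: X_def PiE_iff)
    have eq: "(y(j := t)) i = \<sigma> u i" if i: "i < Suc n" for i
    proof (cases "i = j")
      case False
      obtain i' where i': "i' < n" "skip j i' = i" using skip_surj[OF i False j] .
      have "restrict (\<lambda>i. \<sigma> u (skip j i)) {..<n} = restrict (\<lambda>i. y (skip j i)) {..<n}"
        using \<sigma>u(2) unfolding u_def f_restrict by (simp only: f_def)
      then show ?thesis unfolding restrict_eq_iff using i' False by auto
    qed (simp add: t_def)
    have "A (\<sigma> u)" using \<sigma>u(1) by (simp add: X_def)
    moreover have "A (y(j := t)) \<longleftrightarrow> A (\<sigma> u)" by (rule definable_pred_coords_cong[OF A eq])
    ultimately have "A (y(j := t))" by blast
    moreover have "G (\<lambda>i. (y(j := t)) (skip j i)) (y(j := t))"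
    proof -
      have r: "restrict (\<lambda>i. y (skip j i)) {..<n} = u" unfolding u_def f_restrict ..
      have "restrict (\<sigma> u) {..<Suc n} = \<sigma> u"
        by (rule PiE_restrict) (rule subsetD[OF X \<sigma>u(1)])
      moreover have "restrict (\<sigma> u) {..<Suc n} = restrict (y(j := t)) {..<Suc n}"
        unfolding restrict_eq_iff using eq by simp
      ultimately show ?thesis unfolding G_def sk r using u by simp
    qed
    ultimately have "A' (y(j := t))" by (simp add: A'_def)
    then show "\<exists>t\<in>univ M. A' (y(j := t))" using t by blast
  qed
qed

text \<open>Induction on the bound for the fibres: the points picked by
  \<open>finite_choice_piece\<close> form an injective piece, the rest has smaller fibres, and one
  of the two still has an image with interior.\<close>

lemma exists_injective_piece:
  assumes R: "definable_pred (coords2 (Suc n) k) (\<lambda>p. R (fst p) (snd p))" and j: "j \<le> n"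
  shows "definable_pred (coords (Suc n)) A \<Longrightarrow>
    \<forall>y\<in>assignments. finite {t \<in> univ M. A (y(j := t))} \<and> card {t \<in> univ M. A (y(j := t))} \<le> N \<Longrightarrow>
    has_interior k (\<lambda>z. \<exists>a\<in>assignments. A a \<and> R a z) \<Longrightarrow>
    \<exists>A'. definable_pred (coords (Suc n)) A' \<and>
      (\<forall>y\<in>assignments. \<forall>t\<in>univ M. \<forall>t'\<in>univ M. A' (y(j := t)) \<longrightarrow> A' (y(j := t')) \<longrightarrow> t = t') \<and>
      has_interior k (\<lambda>z. \<exists>a\<in>assignments. A' a \<and> R a z)"
proof (induction N arbitrary: A)
  case 0
  \<comment> \<open>With bound \<open>0\<close> all fibres are empty, whereas an image with interior
    requires a point of \<open>A\<close>.\<close>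
  obtain a where a: "a \<in> assignments" "A a" using has_interior_nonempty[OF 0(3)] by blast
  let ?Y = "{t \<in> univ M. A (a(j := t))}"
  have Y: "finite ?Y" "card ?Y \<le> 0" using 0(2) a(1) by blast+
  have "a j \<in> ?Y" using a assignments_app[OF a(1)] by simp
  moreover have "?Y = {}" using Y(2) unfolding le_zero_eq card_0_eq[OF Y(1)] .
  ultimately show ?case by blast
next
  case (Suc N)
  have "\<forall>y\<in>assignments. finite {t \<in> univ M. A (y(j := t))}" using Suc.prems(2) by blast
  from finite_choice_piece[OF Suc.prems(1) j this] obtain A' where A': "definable_pred (coords (Suc n)) A'"
    "\<forall>a. A' a \<longrightarrow> A a"
    "\<forall>y\<in>assignments. \<forall>t\<in>univ M. \<forall>t'\<in>univ M. A' (y(j := t)) \<longrightarrow> A' (y(j := t')) \<longrightarrow> t = t'"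
    "\<forall>y\<in>assignments. A y \<longrightarrow> (\<exists>t\<in>univ M. A' (y(j := t)))"
    by (elim exE conjE) (rule that)
  have D: "definable_pred (coords (Suc n)) (\<lambda>a. A a \<and> \<not> A' a)" by (intro definable_pred_conj definable_pred_not Suc.prems(1) A'(1))
  have "has_interior k (\<lambda>z. \<exists>a\<in>assignments. (A' a \<or> (A a \<and> \<not> A' a)) \<and> R a z)"
    by (rule has_interior_mono[OF Suc.prems(3)]) blast
  from has_interior_image_disj[OF A'(1) D R this] show ?case
  proof
    assume "has_interior k (\<lambda>z. \<exists>a\<in>assignments. A' a \<and> R a z)"
    then show ?thesis using A'(1,3) by blast
  next
    assume hi: "has_interior k (\<lambda>z. \<exists>a\<in>assignments. (A a \<and> \<not> A' a) \<and> R a z)"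
    have "finite {t \<in> univ M. A (y(j := t)) \<and> \<not> A' (y(j := t))} \<and>
        card {t \<in> univ M. A (y(j := t)) \<and> \<not> A' (y(j := t))} \<le> N" if y: "y \<in> assignments" for y
    proof -
      let ?Y = "{t \<in> univ M. A (y(j := t))}" and ?Y' = "{t \<in> univ M. A (y(j := t)) \<and> \<not> A' (y(j := t))}"
      have Y: "finite ?Y" "card ?Y \<le> Suc N" using Suc.prems(2) y by blast+
      have sub: "?Y' \<subseteq> ?Y" by blast
      have "card ?Y' \<le> N"
      proof (cases "?Y' = {}")
        case False
        then obtain s where s: "s \<in> univ M" "A (y(j := s))" by blast
        \<comment> \<open>The fibre contains a chosen point \<open>t\<close>, which is missing from
          the rest.\<close>
        then obtain t where t: "t \<in> univ M" "A' ((y(j := s))(j := t))"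
          using A'(4) assignments_upd[OF y s(1)] by blast
        then have "A' (y(j := t))" by simp
        then have "t \<in> ?Y" "t \<notin> ?Y'" using A'(2) t(1) by blast+
        then have "?Y' \<subset> ?Y" using sub by blast
        from psubset_card_mono[OF Y(1) this] show ?thesis using Y(2) by linarith
      next
        case True
        then show ?thesis by (simp only: card.empty le0)
      qed
      then show ?thesis using finite_subset[OF sub Y(1)] by blast
    qed
    then show ?thesis using Suc.IH[OF D _ hi] by blast
  qed
qed

text \<open>For \<open>n < k\<close>, the relation would be the graph of a space-filling
  function.\<close>

lemma arity_ge_of_image:
  assumes R: "definable_pred (coords2 n k) (\<lambda>p. R (fst p) (snd p))"
    and functional: "\<forall>a\<in>assignments. \<forall>z\<in>assignments. \<forall>z'\<in>assignments. R a z \<longrightarrow> R a z' \<longrightarrow> (\<forall>i<k. z i = z' i)"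
    and int: "has_interior k (\<lambda>z. \<exists>a\<in>assignments. R a z)"
  shows "k \<le> n"
proof (rule ccontr)
  assume "\<not> k \<le> n"
  then have nk: "n < k" by simp
  define X where "X = {x \<in> tuples (univ M) n. \<exists>z\<in>assignments. R x z}"
  \<comment> \<open>The choice of \<open>g\<close> does no harm to definability: the first
    \<open>k\<close> entries are determined by \<open>functional\<close>, so the graph of
    \<open>f\<close> is given by \<open>R\<close>.\<close>
  define g where "g x = (SOME z. z \<in> assignments \<and> R x z)" for x
  define f where "f x = restrict (g x) {..<k}" for x
  have R_restrict: "R (restrict x {..<n}) z \<longleftrightarrow> R x z" for x z
    by (rule definable_pred_coords2_cong[OF R]) simp_all
  have g: "g x \<in> assignments" "R x (g x)" if "x \<in> X" for x
  proof -
    have "\<exists>z. z \<in> assignments \<and> R x z" using that by (auto simp: X_def)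
    from someI_ex[OF this] show "g x \<in> assignments" "R x (g x)" unfolding g_def by blast+
  qed
  have X: "X \<subseteq> tuples (univ M) n" by (simp add: X_def)
  have f: "f \<in> X \<rightarrow> tuples (univ M) k"
    unfolding f_def using restrict_S g(1) by blast
  have X_iff: "restrict x {..<n} \<in> X \<longleftrightarrow> (\<forall>i<n. x i \<in> univ M) \<and> (\<exists>z\<in>assignments. R x z)" for x
    unfolding X_def using R_restrict[of x] restrict_tuples[of x n] by simp
  have fR: "restrict x {..<n} \<in> X \<and> f (restrict x {..<n}) = restrict z {..<k} \<longleftrightarrow>
      (\<forall>i<n. x i \<in> univ M) \<and> (\<forall>i<k. z i \<in> univ M) \<and> R x z" for x z
  proof
    assume h: "restrict x {..<n} \<in> X \<and> f (restrict x {..<n}) = restrict z {..<k}"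
    define w where "w = g (restrict x {..<n})"
    have w: "w \<in> assignments" "R x w" using g[of "restrict x {..<n}"] h unfolding w_def R_restrict by blast+
    have "restrict w {..<k} = restrict z {..<k}" using h unfolding f_def w_def by blast
    then have wz: "w i = z i" if "i < k" for i using that unfolding restrict_eq_iff by blast
    have "R x w \<longleftrightarrow> R x z" by (rule definable_pred_coords2_cong[OF R]) (simp_all add: wz)
    moreover have "z i \<in> univ M" if "i < k" for i using assignments_app[OF w(1), of i] wz[OF that] by simp
    ultimately show "(\<forall>i<n. x i \<in> univ M) \<and> (\<forall>i<k. z i \<in> univ M) \<and> R x z"
      using h w(2) unfolding X_iff by blast
  next
    assume h: "(\<forall>i<n. x i \<in> univ M) \<and> (\<forall>i<k. z i \<in> univ M) \<and> R x z"
    \<comment> \<open>\<open>functional\<close> speaks about assignments only, hence the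
      padding.\<close>
    have zS: "pad k z \<in> assignments" and xS: "pad n x \<in> assignments" using h by (simp_all add: pad_S)
    have pR: "R (pad n x) (pad k z)"
    proof -
      have "R (pad n x) (pad k z) \<longleftrightarrow> R x z"
        by (rule definable_pred_coords2_cong[OF R]) (simp_all add: pad_less)
      then show ?thesis using h by blast
    qed
    have "R x (pad k z)"
    proof -
      have "R x (pad k z) \<longleftrightarrow> R x z"
        by (rule definable_pred_coords2_cong[OF R]) (simp_all add: pad_less)
      then show ?thesis using h by blast
    qed
    then have xX: "restrict x {..<n} \<in> X" unfolding X_iff using h zS by blast
    define w where "w = g (restrict x {..<n})"
    have w: "w \<in> assignments" "R x w" using g[OF xX] unfolding w_def R_restrict by blast+
    have "R (pad n x) w \<longleftrightarrow> R x w" by (rule definable_pred_coords2_cong[OF R]) (simp_all add: pad_less)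
    then have "R (pad n x) w" using w(2) by blast
    then have "\<forall>i<k. w i = pad k z i" using functional xS w(1) zS pR by blast
    then have "w i = z i" if "i < k" for i using that by (simp add: pad_less)
    then have "f (restrict x {..<n}) = restrict z {..<k}"
      unfolding f_def w_def[symmetric] restrict_eq_iff by blast
    then show "restrict x {..<n} \<in> X \<and> f (restrict x {..<n}) = restrict z {..<k}" using xX by blast
  qed
  have "definable_pred (coords2 n k) (\<lambda>p. (\<forall>i<n. fst p i \<in> univ M) \<and> (\<forall>i<k. snd p i \<in> univ M) \<and> R (fst p) (snd p))"
    by (intro definable_pred_conj definable_pred_all_less definable_pred_univ R coords2I)
  then have "definable L M (n + k) (graph_on n k X f)"
    unfolding definable_graph_iff[OF X f] fR .
  then have "definable_map L M n X k (f ` X) f"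
    unfolding definable_map_def using X f by blast
  from no_filling[OF nk this]
  have "power_topology (def_topology M \<phi> \<psi>) k interior_of (f ` X) = {}" .
  moreover have "has_interior k (\<lambda>z. restrict z {..<k} \<in> f ` X)"
  proof (rule has_interior_mono[OF int])
    fix z assume z: "z \<in> assignments" "\<exists>a\<in>assignments. R a z"
    then obtain a where a: "a \<in> assignments" "R a z" by blast
    have "restrict a {..<n} \<in> X \<and> f (restrict a {..<n}) = restrict z {..<k}"
      unfolding fR using assignments_app[OF a(1)] assignments_app[OF z(1)] a(2) by blast
    then show "restrict z {..<k} \<in> f ` X" by (metis imageI)
  qed
  moreover have "f ` X \<subseteq> tuples (univ M) k" using f by blast
  ultimately show False using interior_power_iff by blast
qed

text \<open>Induction on \<open>n\<close>. If the domain has interior, all coordinates are kept and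
  \<open>k \<le> n\<close> by \<open>arity_ge_of_image\<close>. Otherwise a piece of it is projected
  injectively to one coordinate fewer, while its image keeps an interior.\<close>

lemma domain_dim_ge_image_arity:
  assumes "definable_pred (coords2 n k) (\<lambda>p. R (fst p) (snd p))"
    and "\<forall>a\<in>assignments. \<forall>z\<in>assignments. \<forall>z'\<in>assignments. R a z \<longrightarrow> R a z' \<longrightarrow> (\<forall>i<k. z i = z' i)"
    and "has_interior k (\<lambda>z. \<exists>a\<in>assignments. R a z)"
  shows "\<exists>k'\<ge>k. \<exists>\<iota>. strict_mono_on {..<k'} \<iota> \<and> \<iota> ` {..<k'} \<subseteq> {..<n} \<and>
    has_interior k' (\<lambda>z. \<exists>a\<in>assignments. (\<exists>w\<in>assignments. R a w) \<and> (\<forall>i<k'. z i = a (\<iota> i)))"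
  using assms
proof (induction n arbitrary: R rule: less_induct)
  case (less n)
  note R = less.prems(1) and functional = less.prems(2) and int = less.prems(3)
  define W where "W a \<longleftrightarrow> (\<exists>w\<in>assignments. R a w)" for a
  have "definable_pred (ext_coords (coords n)) (\<lambda>p. R (fst p) (snd p))"
    by (rule definable_pred_coords2_subst[OF R]) (rule ext_coords_snd ext_coords_fst coordsI consts_ext_coords consts_coords | assumption)+
  then have W: "definable_pred (coords n) W" unfolding W_def by (rule definable_pred_ex)
  show ?case
  proof (cases "has_interior n W")
    case True
    have "has_interior n (\<lambda>z. \<exists>a\<in>assignments. (\<exists>w\<in>assignments. R a w) \<and> (\<forall>i<n. z i = a (id i)))"
      by (rule has_interior_mono[OF True]) (use W_def in auto)
    moreover have "strict_mono_on {..<n} (id :: nat \<Rightarrow> nat)" by (simp add: strict_mono_on_def)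
    moreover have "k \<le> n" by (rule arity_ge_of_image[where R = R, OF R functional int])
    moreover have "id ` {..<n} \<subseteq> {..<n}" by simp
    ultimately show ?thesis by blast
  next
    case False
    \<comment> \<open>For \<open>m = n\<close> the only fibre of the domain is the domain itself;
      this starts \<open>exists_finite_fibre_piece\<close>.\<close>
    have "W (merge_at n u y) \<longleftrightarrow> W u" for u y
      by (rule definable_pred_coords_cong[OF W]) (simp add: merge_at_def)
    then have "\<forall>y\<in>assignments. \<not> has_interior n (\<lambda>u. W (merge_at n u y))" using False by simp
    moreover have "has_interior k (\<lambda>z. \<exists>a\<in>assignments. W a \<and> R a z)"
      by (rule has_interior_mono[OF int]) (use W_def in blast)
    ultimately obtain j A where jA: "j < n" "definable_pred (coords n) A"
      "\<forall>y\<in>assignments. finite {t \<in> univ M. A (y(j := t))}" "has_interior k (\<lambda>z. \<exists>a\<in>assignments. A a \<and> R a z)"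
      using exists_finite_fibre_piece[where R = R, OF R order_refl W] by blast
    obtain n' where n': "n = Suc n'" using jA(1) by (cases n) simp_all
    have j: "j \<le> n'" using jA(1) n' by simp
    \<comment> \<open>The induction in \<open>exists_injective_piece\<close> needs one bound for the
      sizes of all fibres in coordinate \<open>j\<close>.\<close>
    have "((\<lambda>p. ((fst p)(j := snd p 0)) i) :: (nat \<Rightarrow> 'u) \<times> (nat \<Rightarrow> 'u) \<Rightarrow> 'u) \<in> ext_coords all_coords" for i
      by (cases "i = j") (simp_all add: ext_coords_snd ext_coords_fst[OF all_coordsI(1)])
    then have "definable_pred (ext_coords all_coords) (\<lambda>p. A ((fst p)(j := snd p 0)))"
      by (rule definable_pred_coords_subst[OF jA(2)]) (rule consts_ext_coords consts_all_coords)+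
    from uniform_finiteness[OF saturated this] obtain N where
      N: "\<forall>y\<in>assignments. card {t \<in> univ M. A (y(j := t))} \<le> N" using jA(3) by blast
    have "\<forall>y\<in>assignments. finite {t \<in> univ M. A (y(j := t))} \<and> card {t \<in> univ M. A (y(j := t))} \<le> N"
      using jA(3) N by blast
    from exists_injective_piece[where R = R, OF R[unfolded n'] j jA(2)[unfolded n'] this jA(4)]
    obtain A' where A': "definable_pred (coords (Suc n')) A'"
      "\<forall>y\<in>assignments. \<forall>t\<in>univ M. \<forall>t'\<in>univ M. A' (y(j := t)) \<longrightarrow> A' (y(j := t')) \<longrightarrow> t = t'"
      "has_interior k (\<lambda>z. \<exists>a\<in>assignments. A' a \<and> R a z)" by (elim exE conjE) (rule that)
    \<comment> \<open>\<open>R'\<close> is \<open>R\<close> on the injective piece, transported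
      along the projection; the forgotten coordinate \<open>t 0\<close> is determined by
      \<open>u\<close>.\<close>
    define R' where "R' u z \<longleftrightarrow> (\<exists>t\<in>assignments. A' (ins j u (t 0)) \<and> R (ins j u (t 0)) z)" for u z
    have c: "(\<lambda>q. ins j (fst (fst q)) (snd q 0) i) \<in> ext_coords (coords2 n' k)" if "i < Suc n'" for i
    proof -
      consider "i < j" | "i = j" | "\<not> i < j" "i \<noteq> j" by blast
      then show ?thesis
      proof cases
        case 1
        then show ?thesis using j by (simp add: ins_def ext_coords_fst[OF coords2I(1)])
      next
        case 2
        then show ?thesis by (simp add: ins_def ext_coords_snd)
      next
        case 3
        then have "i - 1 < n'" using j that by linarith
        then have "(\<lambda>q. fst (fst q) (i - 1)) \<in> ext_coords (coords2 n' k)" by (rule ext_coords_fst[OF coords2I(1)])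
        then show ?thesis using 3 by (simp add: ins_def)
      qed
    qed
    have DR': "definable_pred (coords2 n' k) (\<lambda>p. R' (fst p) (snd p))" unfolding R'_def
    proof (intro definable_pred_ex definable_pred_conj)
      show "definable_pred (ext_coords (coords2 n' k)) (\<lambda>q. A' (ins j (fst (fst q)) (snd q 0)))"
        by (rule definable_pred_coords_subst[OF A'(1) c]) (rule consts_ext_coords consts_coords | assumption)+
      show "definable_pred (ext_coords (coords2 n' k)) (\<lambda>q. R (ins j (fst (fst q)) (snd q 0)) (snd (fst q)))"
        by (rule definable_pred_coords2_subst[OF R[unfolded n'] c])
          (rule ext_coords_fst coords2I consts_ext_coords consts_coords | assumption)+
    qed
    have functional': "\<forall>u\<in>assignments. \<forall>z\<in>assignments. \<forall>z'\<in>assignments. R' u z \<longrightarrow> R' u z' \<longrightarrow> (\<forall>i<k. z i = z' i)"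
    proof (intro ballI impI)
      fix u z z' assume u: "u \<in> assignments" and z: "z \<in> assignments" "z' \<in> assignments" and RR: "R' u z" "R' u z'"
      obtain t where t: "t \<in> assignments" "A' (ins j u (t 0))" "R (ins j u (t 0)) z"
        using RR(1) unfolding R'_def by blast
      obtain t' where t': "t' \<in> assignments" "A' (ins j u (t' 0))" "R (ins j u (t' 0)) z'"
        using RR(2) unfolding R'_def by blast
      have assignments: "ins j u (t 0) \<in> assignments" by (rule ins_S[OF u assignments_app[OF t(1)]])
      have "A' ((ins j u (t 0))(j := t 0))" "A' ((ins j u (t 0))(j := t' 0))"
        unfolding ins_upd by (rule t(2) t'(2))+
      then have "t 0 = t' 0" using A'(2) assignments assignments_app[OF t(1)] assignments_app[OF t'(1)] by blast
      then have "R (ins j u (t 0)) z'" using t'(3) by simp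
      then show "\<forall>i<k. z i = z' i" using functional assignments z t(3) by blast
    qed
    have "has_interior k (\<lambda>z. \<exists>u\<in>assignments. R' u z)"
    proof (rule has_interior_mono[OF A'(3)])
      fix z assume "\<exists>a\<in>assignments. A' a \<and> R a z"
      then obtain a where a: "a \<in> assignments" "A' a" "R a z" by blast
      have "(\<lambda>_. a j) \<in> assignments" "(\<lambda>i. a (skip j i)) \<in> assignments" by (rule assignmentsI, rule assignments_app[OF a(1)])+
      moreover from this have "R' (\<lambda>i. a (skip j i)) z" unfolding R'_def
        using a(2,3) by (intro bexI[of _ "\<lambda>_. a j"]) (simp_all add: ins_same)
      ultimately show "\<exists>u\<in>assignments. R' u z" by blast
    qed
    from less.IH[of n' R', OF _ DR' functional' this] n' obtain k' \<iota> where k': "k \<le> k'"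
      "strict_mono_on {..<k'} \<iota>" "\<iota> ` {..<k'} \<subseteq> {..<n'}"
      "has_interior k' (\<lambda>z. \<exists>u\<in>assignments. (\<exists>w\<in>assignments. R' u w) \<and> (\<forall>i<k'. z i = u (\<iota> i)))" by blast
    \<comment> \<open>Coordinate \<open>\<iota> i\<close> after forgetting \<open>j\<close> is
      coordinate \<open>skip j (\<iota> i)\<close> before.\<close>
    have "has_interior k' (\<lambda>z. \<exists>a\<in>assignments. (\<exists>w\<in>assignments. R a w) \<and> (\<forall>i<k'. z i = a (skip j (\<iota> i))))"
    proof (rule has_interior_mono[OF k'(4)])
      fix z assume "\<exists>u\<in>assignments. (\<exists>w\<in>assignments. R' u w) \<and> (\<forall>i<k'. z i = u (\<iota> i))"
      then obtain u w t where u: "u \<in> assignments" "w \<in> assignments" "t \<in> assignments" "R (ins j u (t 0)) w" "\<forall>i<k'. z i = u (\<iota> i)"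
        unfolding R'_def by blast
      then have "\<forall>i<k'. z i = ins j u (t 0) (skip j (\<iota> i))" by (simp add: ins_skip)
      then show "\<exists>a\<in>assignments. (\<exists>w\<in>assignments. R a w) \<and> (\<forall>i<k'. z i = a (skip j (\<iota> i)))"
        using u(2,4) ins_S[OF u(1) assignments_app[OF u(3)]] by blast
    qed
    moreover have "strict_mono_on {..<k'} (\<lambda>i. skip j (\<iota> i))"
      using k'(2) strict_mono_skip[of j] by (simp add: strict_mono_on_def strict_mono_def)
    moreover have "(\<lambda>i. skip j (\<iota> i)) ` {..<k'} \<subseteq> {..<n}"
    proof (rule image_subsetI)
      fix i assume "i \<in> {..<k'}"
      then have "\<iota> i < n'" using k'(3) by blast
      then show "skip j (\<iota> i) \<in> {..<n}" using skip_less n' by simp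
    qed
    ultimately show ?thesis using k'(1) by blast
  qed
qed

section \<open>Transfer of projections and invariance of dimension\<close>

lemma has_open_proj_iff:
  assumes X: "X \<subseteq> tuples (univ M) n"
  shows "has_open_proj (def_topology M \<phi> \<psi>) n X k \<longleftrightarrow>
    (\<exists>\<iota>. strict_mono_on {..<k} \<iota> \<and> \<iota> ` {..<k} \<subseteq> {..<n} \<and>
      has_interior k (\<lambda>z. \<exists>a\<in>assignments. restrict a {..<n} \<in> X \<and> (\<forall>i<k. z i = a (\<iota> i))))"
proof -
  have "power_topology (def_topology M \<phi> \<psi>) k interior_of (coord_proj k \<iota> ` X) \<noteq> {} \<longleftrightarrow>
      has_interior k (\<lambda>z. \<exists>a\<in>assignments. restrict a {..<n} \<in> X \<and> (\<forall>i<k. z i = a (\<iota> i)))"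
    if \<iota>: "\<iota> ` {..<k} \<subseteq> {..<n}" for \<iota>
  proof -
    have \<iota>_less: "\<iota> i < n" if "i < k" for i using \<iota> that by blast
    have "coord_proj k \<iota> ` X \<subseteq> tuples (univ M) k"
    proof (rule image_subsetI)
      fix x assume "x \<in> X"
      then have "x \<in> tuples (univ M) n" using X by blast
      then have "x i \<in> univ M" if "i < n" for i using that by (simp add: PiE_iff)
      then show "coord_proj k \<iota> x \<in> tuples (univ M) k"
        unfolding coord_proj_def restrict_tuples by (simp add: \<iota>_less)
    qed
    note eq = interior_power_iff[OF this]
    have "restrict z {..<k} \<in> coord_proj k \<iota> ` X \<longleftrightarrow>
        (\<exists>a\<in>assignments. restrict a {..<n} \<in> X \<and> (\<forall>i<k. z i = a (\<iota> i)))" for z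
    proof
      assume "restrict z {..<k} \<in> coord_proj k \<iota> ` X"
      then obtain x where x: "restrict z {..<k} = coord_proj k \<iota> x" "x \<in> X" by (rule imageE)
      have xt: "x \<in> tuples (univ M) n" using X x(2) by blast
      have "restrict (pad n x) {..<n} = x" unfolding restrict_pad using xt by (rule PiE_restrict)
      moreover have "\<forall>i<k. z i = pad n x (\<iota> i)"
        using x(1) unfolding coord_proj_def restrict_eq_iff by (simp add: pad_less \<iota>_less)
      ultimately show "\<exists>a\<in>assignments. restrict a {..<n} \<in> X \<and> (\<forall>i<k. z i = a (\<iota> i))"
        using x(2) pad_tuples[OF xt] by (intro bexI[of _ "pad n x"]) simp_all
    next
      assume "\<exists>a\<in>assignments. restrict a {..<n} \<in> X \<and> (\<forall>i<k. z i = a (\<iota> i))"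
      then obtain a where a: "restrict a {..<n} \<in> X" "\<forall>i<k. z i = a (\<iota> i)" by blast
      have "restrict z {..<k} = coord_proj k \<iota> (restrict a {..<n})"
        unfolding coord_proj_def restrict_eq_iff using a(2) by (simp add: \<iota>_less)
      then show "restrict z {..<k} \<in> coord_proj k \<iota> ` X" using a(1) by (rule image_eqI)
    qed
    then show ?thesis unfolding eq by (simp only:)
  qed
  then show ?thesis unfolding has_open_proj_def by (intro ex_cong1 conj_cong refl)
qed

text \<open>\<open>G y x\<close> is read as a partial map \<open>y \<mapsto> x\<close> defined
  inside \<open>Y\<close> and covering \<open>X\<close>. Its composition with the projection of
  \<open>X\<close> has an image with interior, so \<open>domain_dim_ge_image_arity\<close> provides
  a projection of \<open>Y\<close>.\<close>

lemma has_open_proj_transfer: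
  assumes X: "X \<subseteq> tuples (univ M) m" and Y: "Y \<subseteq> tuples (univ M) n"
    and G: "definable_pred (coords2 n m) (\<lambda>p. G (fst p) (snd p))"
    and total: "\<And>x. x \<in> assignments \<Longrightarrow> restrict x {..<m} \<in> X \<Longrightarrow> \<exists>y\<in>assignments. G y x"
    and into: "\<And>x y. G y x \<Longrightarrow> restrict y {..<n} \<in> Y"
    and functional: "\<forall>x x' y. G y x \<longrightarrow> G y x' \<longrightarrow> (\<forall>i<m. x i = x' i)"
    and proj: "has_open_proj (def_topology M \<phi> \<psi>) m X k"
  shows "\<exists>k'\<ge>k. has_open_proj (def_topology M \<phi> \<psi>) n Y k'"
proof -
  obtain \<iota> where \<iota>: "\<iota> ` {..<k} \<subseteq> {..<m}"
    "has_interior k (\<lambda>z. \<exists>a\<in>assignments. restrict a {..<m} \<in> X \<and> (\<forall>i<k. z i = a (\<iota> i)))"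
    using proj unfolding has_open_proj_iff[OF X] by blast
  have \<iota>_less: "\<iota> i < m" if "i < k" for i using \<iota>(1) that by blast
  define R where "R y z \<longleftrightarrow> (\<exists>x\<in>assignments. G y x \<and> (\<forall>i<k. z i = x (\<iota> i)))" for y z
  have "definable_pred (coords2 n k) (\<lambda>p. R (fst p) (snd p))" unfolding R_def
  proof (intro definable_pred_ex definable_pred_conj definable_pred_all_less)
    show "definable_pred (ext_coords (coords2 n k)) (\<lambda>q. G (fst (fst q)) (snd q))"
      by (rule definable_pred_coords2_subst[OF G]) (rule ext_coords_snd ext_coords_fst coords2I consts_ext_coords consts_coords | assumption)+
    show "definable_pred (ext_coords (coords2 n k)) (\<lambda>q. snd (fst q) i = snd q (\<iota> i))" if "i < k" for i
      by (rule definable_pred_eq[OF ext_coords_fst[OF coords2I(2)[OF that]] ext_coords_snd])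
  qed
  moreover have "\<forall>y\<in>assignments. \<forall>z\<in>assignments. \<forall>z'\<in>assignments. R y z \<longrightarrow> R y z' \<longrightarrow> (\<forall>i<k. z i = z' i)"
  proof (intro ballI impI allI)
    fix y z z' i assume R: "R y z" "R y z'" and i: "i < k"
    obtain x x' where x: "G y x" "G y x'" "\<forall>i<k. z i = x (\<iota> i)" "\<forall>i<k. z' i = x' (\<iota> i)"
      using R unfolding R_def by blast
    have "x (\<iota> i) = x' (\<iota> i)" using functional x(1,2) \<iota>_less[OF i] by blast
    then show "z i = z' i" using x(3,4) i by simp
  qed
  moreover have "has_interior k (\<lambda>z. \<exists>y\<in>assignments. R y z)"
  proof (rule has_interior_mono[OF \<iota>(2)])
    fix z assume "\<exists>a\<in>assignments. restrict a {..<m} \<in> X \<and> (\<forall>i<k. z i = a (\<iota> i))"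
    then obtain a where a: "a \<in> assignments" "restrict a {..<m} \<in> X" "\<forall>i<k. z i = a (\<iota> i)" by blast
    obtain y where "y \<in> assignments" "G y a" using total[OF a(1,2)] by blast
    then show "\<exists>y\<in>assignments. R y z" unfolding R_def using a(1,3) by blast
  qed
  ultimately have "\<exists>k'\<ge>k. \<exists>\<iota>. strict_mono_on {..<k'} \<iota> \<and> \<iota> ` {..<k'} \<subseteq> {..<n} \<and>
      has_interior k' (\<lambda>z. \<exists>y\<in>assignments. (\<exists>w\<in>assignments. R y w) \<and> (\<forall>i<k'. z i = y (\<iota> i)))"
    by (rule domain_dim_ge_image_arity)
  then obtain k' \<iota>' where k': "k \<le> k'" "strict_mono_on {..<k'} \<iota>'" "\<iota>' ` {..<k'} \<subseteq> {..<n}"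
    "has_interior k' (\<lambda>z. \<exists>y\<in>assignments. (\<exists>w\<in>assignments. R y w) \<and> (\<forall>i<k'. z i = y (\<iota>' i)))" by blast
  have "has_interior k' (\<lambda>z. \<exists>y\<in>assignments. restrict y {..<n} \<in> Y \<and> (\<forall>i<k'. z i = y (\<iota>' i)))"
  proof (rule has_interior_mono[OF k'(4)])
    fix z assume "\<exists>y\<in>assignments. (\<exists>w\<in>assignments. R y w) \<and> (\<forall>i<k'. z i = y (\<iota>' i))"
    then obtain y x where y: "y \<in> assignments" "G y x" "\<forall>i<k'. z i = y (\<iota>' i)" unfolding R_def by blast
    then show "\<exists>y\<in>assignments. restrict y {..<n} \<in> Y \<and> (\<forall>i<k'. z i = y (\<iota>' i))" using into[OF y(2)] by blast
  qed
  then show ?thesis using k'(1-3) unfolding has_open_proj_iff[OF Y] by blast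
qed

text \<open>The form with a relation \<open>G\<close> allows one graph to be used in both
  directions.\<close>

lemma top_dim_mono:
  assumes X: "X \<subseteq> tuples (univ M) m" and Y: "Y \<subseteq> tuples (univ M) n"
    and G: "definable_pred (coords2 n m) (\<lambda>p. G (fst p) (snd p))"
    and total: "\<And>x. x \<in> assignments \<Longrightarrow> restrict x {..<m} \<in> X \<Longrightarrow> \<exists>y\<in>assignments. G y x"
    and into: "\<And>x y. G y x \<Longrightarrow> restrict y {..<n} \<in> Y"
    and functional: "\<forall>x x' y. G y x \<longrightarrow> G y x' \<longrightarrow> (\<forall>i<m. x i = x' i)"
  shows "top_dim (def_topology M \<phi> \<psi>) m X \<le> top_dim (def_topology M \<phi> \<psi>) n Y"
proof (cases "X = {}")
  case True
  then show ?thesis by (simp add: top_dim_def)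
next
  case False
  \<comment> \<open>A point of \<open>X\<close> yields one of \<open>Y\<close>, which excludes the
    dimension \<open>-1\<close> for \<open>Y\<close>.\<close>
  then obtain x where x: "x \<in> X" by blast
  then have xt: "x \<in> tuples (univ M) m" using X by blast
  have px: "restrict (pad m x) {..<m} = x" unfolding restrict_pad using xt by (rule PiE_restrict)
  then have pX: "restrict (pad m x) {..<m} \<in> X" using x by simp
  then obtain y where "y \<in> assignments" "G y (pad m x)" using total[OF pad_tuples[OF xt]] by blast
  then have nonempty: "Y \<noteq> {}" using into by blast
  define P where "P k \<longleftrightarrow> k \<le> m \<and> has_open_proj (def_topology M \<phi> \<psi>) m X k" for k
  define Q where "Q k \<longleftrightarrow> k \<le> n \<and> has_open_proj (def_topology M \<phi> \<psi>) n Y k" for k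
  obtain b where b: "b \<in> indices" using indices_nonempty by blast
  \<comment> \<open>\<open>k = 0\<close> qualifies for the nonempty set \<open>X\<close>, so the
    greatest \<open>k\<close> is attained.\<close>
  have "has_interior 0 (\<lambda>z. \<exists>a\<in>assignments. restrict a {..<m} \<in> X \<and> (\<forall>i<0. z i = a (id i)))"
    using pad_tuples[OF xt] pX by (intro has_interiorI[OF pad_tuples[OF xt] b]) blast
  then have "has_open_proj (def_topology M \<phi> \<psi>) m X 0"
    unfolding has_open_proj_iff[OF X] by (intro exI[of _ id]) (simp add: strict_mono_on_def)
  then have "P 0" by (simp add: P_def)
  then have "P (Greatest P)" by (rule GreatestI_nat[where b = m]) (simp add: P_def)
  then have "has_open_proj (def_topology M \<phi> \<psi>) m X (Greatest P)" unfolding P_def by (rule conjunct2)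
  from has_open_proj_transfer[OF X Y G _ _ functional this]
  have "\<exists>k'\<ge>Greatest P. has_open_proj (def_topology M \<phi> \<psi>) n Y k'" using total into by blast
  then obtain k' where k': "Greatest P \<le> k'" "has_open_proj (def_topology M \<phi> \<psi>) n Y k'" by blast
  obtain \<iota> where \<iota>: "strict_mono_on {..<k'} \<iota>" "\<iota> ` {..<k'} \<subseteq> {..<n}"
    using k'(2) unfolding has_open_proj_def by blast
  \<comment> \<open>A strictly increasing map is injective; hence \<open>k' \<le> n\<close>, as the
    maximum in the dimension of \<open>Y\<close> requires.\<close>
  have "card {..<k'} \<le> card {..<n}"
    by (rule card_inj_on_le[OF strict_mono_on_imp_inj_on[OF \<iota>(1)] \<iota>(2)]) simp
  then have "Q k'" using k'(2) by (simp add: Q_def)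
  then have "k' \<le> Greatest Q" by (rule Greatest_le_nat[where b = n]) (simp add: Q_def)
  then have "Greatest P \<le> Greatest Q" using k'(1) by linarith
  then show ?thesis using False nonempty unfolding top_dim_def P_def Q_def by simp
qed

lemma top_dim_bij_betw:
  assumes f: "definable_map L M m X n Y f" and bij: "bij_betw f X Y"
  shows "top_dim (def_topology M \<phi> \<psi>) m X = top_dim (def_topology M \<phi> \<psi>) n Y"
proof (rule antisym)
  define G where "G x y \<longleftrightarrow> restrict x {..<m} \<in> X \<and> f (restrict x {..<m}) = restrict y {..<n}"
    for x y :: "nat \<Rightarrow> 'u"
  have X: "X \<subseteq> tuples (univ M) m" and Y: "Y \<subseteq> tuples (univ M) n" and fXY: "f \<in> X \<rightarrow> Y"
    using f by (simp_all add: definable_map_def)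
  then have "f \<in> X \<rightarrow> tuples (univ M) n" by blast
  from definable_graph_iff[OF X this] have G: "definable_pred (coords2 m n) (\<lambda>p. G (fst p) (snd p))"
    using f unfolding G_def definable_map_def by blast
  \<comment> \<open>The graph is read backwards, as a map from \<open>Y\<close> onto
    \<open>X\<close>; it is functional since \<open>f\<close> is injective.\<close>
  have "definable_pred (coords2 n m) (\<lambda>p. G (snd p) (fst p))"
    by (rule definable_pred_coords2_subst[OF G]) (rule coords2I consts_coords | assumption)+
  then show "top_dim (def_topology M \<phi> \<psi>) m X \<le> top_dim (def_topology M \<phi> \<psi>) n Y"
  proof (rule top_dim_mono[OF X Y])
    fix x assume x: "x \<in> assignments" "restrict x {..<m} \<in> X"
    then have "f (restrict x {..<m}) \<in> tuples (univ M) n" using fXY Y by blast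
    note t = this pad_tuples[OF this]
    have "restrict (pad n (f (restrict x {..<m}))) {..<n} = f (restrict x {..<m})"
      unfolding restrict_pad using t(1) by (rule PiE_restrict)
    then show "\<exists>y\<in>assignments. G x y" using x(2) t(2) unfolding G_def by (intro bexI[of _ "pad n (f (restrict x {..<m}))"]) simp_all
  next
    fix x y assume G: "G x y"
    then have "f (restrict x {..<m}) \<in> Y" using fXY unfolding G_def by blast
    then show "restrict y {..<n} \<in> Y" using G unfolding G_def by simp
  next
    show "\<forall>x x' y. G x y \<longrightarrow> G x' y \<longrightarrow> (\<forall>i<m. x i = x' i)"
    proof (intro allI impI)
      fix x x' y i assume h: "G x y" "G x' y" "i < m"
      have "restrict x {..<m} = restrict x' {..<m}"
        by (rule inj_onD[OF bij_betw_imp_inj_on[OF bij]]) (use h(1,2) in \<open>simp_all add: G_def\<close>)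
      then show "x i = x' i" unfolding restrict_eq_iff using h(3) by blast
    qed
  qed
  \<comment> \<open>The graph is read forwards; it covers \<open>Y\<close> since \<open>f\<close> is
    surjective.\<close>
  show "top_dim (def_topology M \<phi> \<psi>) n Y \<le> top_dim (def_topology M \<phi> \<psi>) m X"
  proof (rule top_dim_mono[OF Y X G])
    fix y assume y: "y \<in> assignments" "restrict y {..<n} \<in> Y"
    then have "restrict y {..<n} \<in> f ` X" using bij_betw_imp_surj_on[OF bij] by simp
    then obtain x where x: "restrict y {..<n} = f x" "x \<in> X" by (rule imageE)
    have xt: "x \<in> tuples (univ M) m" using x(2) X by blast
    have "restrict (pad m x) {..<m} = x" unfolding restrict_pad using xt by (rule PiE_restrict)
    then have "G (pad m x) y" unfolding G_def using x by simp
    then show "\<exists>x\<in>assignments. G x y" using pad_tuples[OF xt] by blast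
  next
    fix y x assume "G x y"
    then show "restrict x {..<m} \<in> X" by (simp add: G_def)
  next
    show "\<forall>y y' x. G x y \<longrightarrow> G x y' \<longrightarrow> (\<forall>i<n. y i = y' i)"
      unfolding G_def restrict_eq_iff[symmetric] by simp
  qed
qed

end

theorem theorem3p27:
  fixes L :: "('f, 'r) language"
    and T :: "('f, 'r) formula set"
    and M :: "('f, 'r, 'u) fo_struct"
    and \<phi> \<psi> :: "('f, 'r) formula"
    and m n :: nat
    and X Y :: "(nat \<Rightarrow> 'u) set"
    and f :: "(nat \<Rightarrow> 'u) \<Rightarrow> nat \<Rightarrow> 'u"
  assumes "complete_theory L T"
    and "visceral_theory TYPE('u) L T"
    and "definable_finite_choice TYPE('u) L T"
    and "no_space_filling TYPE('u) L T \<phi> \<psi>"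
    and "is_model L T M"
    and "omega_saturated L M"
    and "visceral L M \<phi> \<psi>"
    and "definable L M m X"
    and "definable L M n Y"
    and "definable_map L M m X n Y f"
    and "bij_betw f X Y"
  shows "top_dim (def_topology M \<phi> \<psi>) m X = top_dim (def_topology M \<phi> \<psi>) n Y"
proof -
  \<comment> \<open>Finite choice and the absence of space-filling functions are instantiated with
    \<open>M\<close> itself, an \<open>\<omega>\<close>-saturated model of \<open>T\<close>.\<close>
  interpret tame_structure L M \<phi> \<psi>
  proof
    show "univ M \<noteq> {}" using assms(5) by (simp add: is_model_def is_struct_def)
    show "omega_saturated L M" "visceral L M \<phi> \<psi>" by (rule assms)+
    show "\<exists>\<sigma>. definable_map L M k (f ` X) l X \<sigma> \<and> (\<forall>y\<in>f ` X. f (\<sigma> y) = y)"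
      if "definable_map L M l X k (tuples (univ M) k) f"
        "\<And>y. y \<in> f ` X \<Longrightarrow> finite {x \<in> X. f x = y}" for l k X f
      using assms(3,5,6) that unfolding definable_finite_choice_def by blast
    show "power_topology (def_topology M \<phi> \<psi>) k interior_of (f ` X) = {}"
      if "l < k" "definable_map L M l X k (f ` X) f" for l k X f
      using assms(4,5) that unfolding no_space_filling_def by blast
  qed
  show ?thesis using assms(10,11) by (rule top_dim_bij_betw)
qed

end
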